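(* Consider the mixed random environment model with drift parameter $\delta \in (-1,1)$ described in the context. Suppose that the distribution of $\zeta_0$ is symmetric about $0$, i.e. $\mathbb{P}[\zeta_0 \le -x] = \mathbb{P}[\zeta_0 \ge x]$ for all $x \ge 0$, and that for some $\alpha \in (0,1)$ and some $c \in (0,\infty)$, $\mathbb{P}[\zeta_0 > r] \sim c r^{-\alpha}$ as $r \to \infty$. Suppose that $\phi(n) = 1 - n^{-\beta}$ for all $n \ge 1$ (with $\phi(0) \in [0,1]$ arbitrary), where $\beta \in (0,1)$. (i) Suppose that $\beta < 1 - \alpha$. Then (for any $\delta \in (-1,1)$) $X$ is recurrent for $\mathbb{P}$-a.e. $\omega$. (ii) Suppose that $\beta > 1 - \alpha$. If $\delta < 0$, then $X$ is recurrent for $\mathbb{P}$-a.e. $\omega$. If $\delta > 0$, then $X$ is transient for $\mathbb{P}$-a.e. $\omega$.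
   Context: Random environment. Let $\mathbb{Z}_+ = \{0,1,2,\ldots\}$. Fix $\delta \in (-1,1)$ and a function $\phi : \mathbb{Z}_+ \to [0,1]$. On a probability space $(\Omega,\mathcal{F},\mathbb{P})$ (with expectation $\mathbb{E}$), let $\chi_0,\chi_1,\ldots$ be independent $\{0,1\}$-valued random variables with $\mathbb{P}[\chi_n = 1] = \phi(n)$, and let $\xi_0,\xi_1,\ldots$ be i.i.d. $(0,1)$-valued random variables, independent of the $\chi_i$. Set $p_n = \frac{1-\delta}{2}\chi_n + \xi_n(1-\chi_n)$, $q_n = 1-p_n$, and $\zeta_n = \log\left(\frac{\xi_n}{1-\xi_n}\right)$. The environment is $\omega = (p_0,p_1,p_2,\ldots)$. Random walk. For fixed $\omega$, under the quenched law $P_\omega$, $X = (X_t)_{t \in \mathbb{Z}_+}$ is the Markov chain on $\mathbb{Z}_+$ with $X_0 = 0$ and, for $n \ge 1$, $P_\omega[X_{t+1} = n-1 \mid X_t = n] = p_n$ and $P_\omega[X_{t+1} = n+1 \mid X_t = n] = q_n$; and $P_\omega[X_{t+1} = 0 \mid X_t = 0] = p_0$, $P_\omega[X_{t+1} = 1 \mid X_t = 0] = q_0$. It is irreducible and aperiodic. "Recurrent" and "transient" refer to this Markov chain under $P_\omega$. The notation $\sim$ means that the ratio of the two sides tends to $1$. *)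

theory Defs
  imports "HOL-Probability.Probability" "HOL-Library.Landau_Symbols"
begin

section \<open>Time-homogeneous Markov chains on a discrete state space\<close>

text \<open>The conditional law of the state at time \<open>t\<close> given the path \<open>x\<close> up to time \<open>t - 1\<close>,
  for the chain with transition kernel \<open>K\<close> started at \<open>i\<close>.\<close>

definition path_kernel :: "('s \<Rightarrow> 's pmf) \<Rightarrow> 's \<Rightarrow> nat \<Rightarrow> (nat \<Rightarrow> 's) \<Rightarrow> 's measure" where
  "path_kernel K i t x = measure_pmf (case t of 0 \<Rightarrow> return_pmf i | Suc s \<Rightarrow> K (x s))"

global_interpretation chain: Ionescu_Tulcea "path_kernel K i" "\<lambda>_. count_space UNIV" for K i
proof (rule Ionescu_Tulcea.intro)
  fix t :: nat
  let ?S = "\<lambda>_::nat. count_space (UNIV :: 'a set)"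
  show "path_kernel K i t \<in> measurable (PiM {0..<t} ?S) (subprob_algebra (count_space UNIV))"
  proof (cases t)
    case 0
    then have "path_kernel K i t = (\<lambda>_. measure_pmf (return_pmf i))"
      by (simp add: path_kernel_def[abs_def])
    then show ?thesis
      by (simp add: measure_pmf_in_subprob_algebra)
  next
    case (Suc s)
    have "(\<lambda>x. x s) \<in> measurable (PiM {0..<t} ?S) (count_space UNIV)"
      by (rule measurable_component_singleton) (simp add: Suc)
    moreover have "(\<lambda>n. measure_pmf (K n)) \<in> measurable (count_space UNIV) (subprob_algebra (count_space UNIV))"
      by (simp add: measure_pmf_in_subprob_algebra)
    ultimately have "(\<lambda>x. measure_pmf (K (x s))) \<in>
        measurable (PiM {0..<t} ?S) (subprob_algebra (count_space UNIV))"
      by (rule measurable_compose)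
    then show ?thesis using Suc by (simp add: path_kernel_def[abs_def])
  qed
qed (unfold path_kernel_def, rule measure_pmf.prob_space_axioms)

text \<open>The law, on path space, of the Markov chain with transition kernel \<open>K\<close> started at \<open>i\<close>.
  It is a measure on the product \<open>\<sigma>\<close>-algebra of \<open>\<Pi>\<^sub>M t\<in>UNIV. count_space UNIV\<close>; the chain
  is the coordinate process. The lemmas below characterise it.\<close>

definition chain_law :: "('s \<Rightarrow> 's pmf) \<Rightarrow> 's \<Rightarrow> (nat \<Rightarrow> 's) measure" where
  "chain_law K i = chain.PF.lim K i"

lemma sets_chain_law [measurable_cong]:
  "sets (chain_law K i) = sets (\<Pi>\<^sub>M t\<in>UNIV. count_space UNIV)"
  by (simp add: chain_law_def)

lemma space_chain_law [simp]: "space (chain_law K i) = UNIV"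
  using sets_eq_imp_space_eq[OF sets_chain_law] by (simp add: space_PiM)

lemma emeasure_chain_law_prefix:
  assumes A: "A \<in> sets (PiM {0..<n} (\<lambda>_. count_space UNIV))"
  shows "emeasure (chain_law K i) {x. restrict x {0..<n} \<in> A} = emeasure (chain.C K i 0 n (\<lambda>_. undefined)) A"
proof -
  have "emeasure (chain_law K i) (chain.PF.emb UNIV {0..<n} A) = emeasure (chain.CI K i {0..<n}) A"
    unfolding chain_law_def by (rule chain.lim) (use A in auto)
  also have "\<dots> = emeasure (chain.C K i 0 n (\<lambda>_. undefined)) (chain.PF.emb {0..<n} {0..<n} A)"
    by (rule chain.emeasure_CI) (use A in auto)
  also have "chain.PF.emb {0..<n} {0..<n} A = A"
    by (rule prod_emb_id) (use sets.sets_into_space[OF A] in \<open>simp add: space_PiM\<close>)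
  also have "chain.PF.emb UNIV {0..<n} A = {x. restrict x {0..<n} \<in> A}"
    by (auto simp: prod_emb_def)
  finally show ?thesis .
qed

lemma emeasure_return_PiM_empty:
  "emeasure (return (PiM {} S) (\<lambda>_. undefined)) {\<lambda>_. undefined} = 1"
proof -
  have "{\<lambda>_. undefined} \<in> sets (PiM {} S)" unfolding sets_PiM_empty by blast
  from emeasure_return[OF this, of "\<lambda>_. undefined"] show ?thesis unfolding indicator_def by simp
qed

lemma prob_space_chain_law: "prob_space (chain_law K i)"
proof
  have "{\<lambda>_. undefined} \<in> sets (PiM {0..<0::nat} (\<lambda>_. count_space (UNIV :: 'a set)))"
    by (simp add: sets_PiM_empty)
  from emeasure_chain_law_prefix[OF this, of K i]
  show "emeasure (chain_law K i) (space (chain_law K i)) = 1"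
    by (simp add: emeasure_return_PiM_empty restrict_def)
qed

lemma emeasure_chain_C_path:
  "emeasure (chain.C K i 0 n (\<lambda>_. undefined)) (PiE {0..<n} (\<lambda>s. {y s})) =
    (\<Prod>t<n. emeasure (path_kernel K i t y) {y t})"
proof (induction n)
  case 0
  then show ?case by (simp add: emeasure_return_PiM_empty)
next
  case (Suc n)
  let ?S = "\<lambda>_::nat. count_space UNIV"
  let ?A = "\<lambda>n. PiE {0..<n} (\<lambda>s. {y s})"
  have A: "?A n \<in> sets (PiM {0..<n} ?S)" for n
    by (intro sets_PiM_I_finite) auto
  have "emeasure (chain.C K i 0 (Suc n) (\<lambda>_. undefined)) (?A (Suc n)) =
      (\<integral>\<^sup>+x. emeasure (chain.eP K i n x) (?A (Suc n)) \<partial>chain.C K i 0 n (\<lambda>_. undefined))"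
    unfolding chain.C.simps
  proof (subst emeasure_bind)
    show "space (chain.C K i 0 n (\<lambda>_. undefined)) \<noteq> {}"
      by (simp add: chain.space_C space_PiM PiE_eq_empty_iff)
    show "chain.eP K i (0 + n) \<in> measurable (chain.C K i 0 n (\<lambda>_. undefined))
        (subprob_algebra (PiM {0..<Suc n} ?S))"
      using chain.measurable_eP[of K i n]
      by (simp add: measurable_cong_sets[OF chain.sets_C refl] space_PiM)
    show "?A (Suc n) \<in> sets (PiM {0..<Suc n} ?S)" by (rule A)
  qed simp
  also have "\<dots> = (\<integral>\<^sup>+x. emeasure (path_kernel K i n y) {y n} * indicator (?A n) x
                    \<partial>chain.C K i 0 n (\<lambda>_. undefined))"
  proof (rule nn_integral_cong)
    fix x assume "x \<in> space (chain.C K i 0 n (\<lambda>_. undefined))"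
    then have x: "x \<in> space (PiM {0..<n} ?S)"
      by (simp add: chain.space_C space_PiM)
    have "emeasure (chain.eP K i n x) (?A (Suc n)) =
        emeasure (path_kernel K i n x) {z. x(n := z) \<in> ?A (Suc n)}"
      using x A by (subst chain.emeasure_eP) (auto simp: vimage_def)
    also have "{z. x(n := z) \<in> ?A (Suc n)} = (if x \<in> ?A n then {y n} else {})"
      using x by (auto simp: PiE_iff extensional_def space_PiM less_Suc_eq)
    also have "emeasure (path_kernel K i n x) \<dots> =
        emeasure (path_kernel K i n y) {y n} * indicator (?A n) x"
      by (auto simp: path_kernel_def PiE_iff split: nat.split)
    finally show "emeasure (chain.eP K i n x) (?A (Suc n)) =
        emeasure (path_kernel K i n y) {y n} * indicator (?A n) x" .
  qed
  also have "\<dots> = emeasure (path_kernel K i n y) {y n} *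
      emeasure (chain.C K i 0 n (\<lambda>_. undefined)) (?A n)"
    using A[of n] by (subst nn_integral_cmult_indicator) (auto simp: chain.sets_C space_PiM)
  finally show ?case
    using Suc by (simp add: mult.commute)
qed

lemma emeasure_chain_law_path:
  "emeasure (chain_law K i) {x. \<forall>t\<le>n. x t = y t} =
    (if y 0 = i then \<Prod>t<n. pmf (K (y t)) (y (Suc t)) else 0)"
proof -
  have "{x. \<forall>t\<le>n. x t = y t} = {x. restrict x {0..<Suc n} \<in> PiE {0..<Suc n} (\<lambda>s. {y s})}"
    unfolding restrict_PiE_iff by (auto simp: less_Suc_eq_le)
  then have "emeasure (chain_law K i) {x. \<forall>t\<le>n. x t = y t} =
      (\<Prod>t<Suc n. emeasure (path_kernel K i t y) {y t})"
    using emeasure_chain_law_prefix[of "PiE {0..<Suc n} (\<lambda>s. {y s})" "Suc n" K i]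
    by (simp only: emeasure_chain_C_path) (auto intro: sets_PiM_I_finite)
  also have "\<dots> = emeasure (return_pmf i) {y 0} * (\<Prod>t<n. ennreal (pmf (K (y t)) (y (Suc t))))"
    unfolding prod.lessThan_Suc_shift by (simp add: path_kernel_def emeasure_pmf_single)
  also have "(\<Prod>t<n. ennreal (pmf (K (y t)) (y (Suc t)))) = ennreal (\<Prod>t<n. pmf (K (y t)) (y (Suc t)))"
    by (rule prod_ennreal) simp
  also have "emeasure (return_pmf i) {y 0} = (if y 0 = i then 1 else 0)"
    by (simp add: indicator_def)
  finally show ?thesis
    by (cases "y 0 = i") simp_all
qed

text \<open>A state is recurrent if the chain started there returns to it almost surely, and transient
  otherwise; a chain is recurrent (transient) if all its states are. For irreducible chains, such
  as the random walk below when all \<open>p n\<close> lie in \<open>(0,1)\<close>, all states are of the same type.\<close>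

definition return_prob :: "('s \<Rightarrow> 's pmf) \<Rightarrow> 's \<Rightarrow> real" where
  "return_prob K i = measure (chain_law K i) {x. \<exists>t\<ge>1. x t = i}"

definition recurrent_chain :: "('s \<Rightarrow> 's pmf) \<Rightarrow> bool" where
  "recurrent_chain K \<longleftrightarrow> (\<forall>i. return_prob K i = 1)"

definition transient_chain :: "('s \<Rightarrow> 's pmf) \<Rightarrow> bool" where
  "transient_chain K \<longleftrightarrow> (\<forall>i. return_prob K i < 1)"

section \<open>The random walk in a fixed environment\<close>

text \<open>From \<open>n\<close> the walk steps down with probability \<open>p n\<close> and up otherwise. At \<open>n = 0\<close>,
  truncated subtraction turns the downward step into staying at \<open>0\<close>. Note that
  \<open>bernoulli_pmf\<close> is only meaningful for parameters in \<open>[0,1]\<close>.\<close>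

definition walk_kernel :: "(nat \<Rightarrow> real) \<Rightarrow> nat \<Rightarrow> nat pmf" where
  "walk_kernel p n = map_pmf (\<lambda>down. if down then n - 1 else n + 1) (bernoulli_pmf (p n))"

lemma pmf_walk_kernel:
  assumes "p n \<in> {0..1}"
  shows "pmf (walk_kernel p n) (n - 1) = p n" "pmf (walk_kernel p n) (n + 1) = 1 - p n"
proof -
  have "pmf (walk_kernel p n) ((\<lambda>down. if down then n - 1 else n + 1) b) = pmf (bernoulli_pmf (p n)) b" for b
    unfolding walk_kernel_def by (rule pmf_map_inj') (auto simp: inj_def)
  from this[of True] this[of False] assms
  show "pmf (walk_kernel p n) (n - 1) = p n" "pmf (walk_kernel p n) (n + 1) = 1 - p n"
    by auto
qed

section \<open>The mixed random environment\<close>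

text \<open>\<open>site_prob \<delta> chi \<xi> w\<close> is the environment \<open>(p\<^sub>0, p\<^sub>1, \<dots>)\<close> at the sample point \<open>w\<close>.\<close>

definition site_prob ::
    "real \<Rightarrow> (nat \<Rightarrow> 'a \<Rightarrow> real) \<Rightarrow> (nat \<Rightarrow> 'a \<Rightarrow> real) \<Rightarrow> 'a \<Rightarrow> nat \<Rightarrow> real" where
  "site_prob \<delta> chi \<xi> w n = (1 - \<delta>) / 2 * chi n w + \<xi> n w * (1 - chi n w)"

definition log_odds :: "(nat \<Rightarrow> 'a \<Rightarrow> real) \<Rightarrow> nat \<Rightarrow> 'a \<Rightarrow> real" where
  "log_odds \<xi> n w = ln (\<xi> n w / (1 - \<xi> n w))"

text \<open>The variables \<open>chi n\<close> are taken real-valued with values in \<open>{0,1}\<close>. The whole sequences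
  \<open>chi\<close> and \<open>\<xi>\<close> are independent of each other, as random elements of the sequence space.\<close>

locale mixed_environment = prob_space M
  for M :: "'a measure" +
  fixes \<delta> :: real
    and \<phi> :: "nat \<Rightarrow> real"
    and chi \<xi> :: "nat \<Rightarrow> 'a \<Rightarrow> real"
  assumes delta: "\<delta> \<in> {-1<..<1}"
    and phi: "\<And>n. \<phi> n \<in> {0..1}"
    and chi_values: "\<And>n w. w \<in> space M \<Longrightarrow> chi n w \<in> {0, 1}"
    and chi_prob: "\<And>n. prob {w \<in> space M. chi n w = 1} = \<phi> n"
    and chi_indep: "indep_vars (\<lambda>_. borel) chi UNIV"
    and xi_values: "\<And>n w. w \<in> space M \<Longrightarrow> \<xi> n w \<in> {0<..<1}"
    and xi_indep: "indep_vars (\<lambda>_. borel) \<xi> UNIV"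
    and xi_ident: "\<And>n. distr M borel (\<xi> n) = distr M borel (\<xi> 0)"
    and chi_xi_indep: "indep_var (\<Pi>\<^sub>M n\<in>UNIV. borel) (\<lambda>w n. chi n w) (\<Pi>\<^sub>M n\<in>UNIV. borel) (\<lambda>w n. \<xi> n w)"
begin

lemma site_prob_in_unit_interval:
  assumes "w \<in> space M"
  shows "site_prob \<delta> chi \<xi> w n \<in> {0<..<1}"
  using chi_values[OF assms, of n] xi_values[OF assms, of n] delta by (auto simp: site_prob_def)

end

end

theory Submission
  imports Defs
begin

text \<open>The walk is recurrent iff \<open>\<Sum>\<^sub>n exp (V n)\<close> diverges, where \<open>V\<close> is the potential with increments
  \<open>log (p\<^sub>k / q\<^sub>k)\<close>. Up to \<open>n\<close>, the potential is a linear drift of slope \<open>log ((1 - \<delta>) / (1 + \<delta>))\<close>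
  perturbed at the roughly \<open>n\<^bsup>1 - \<beta>\<^esup>\<close> sites with \<open>\<chi>\<^sub>k = 0\<close>, where it jumps by \<open>\<zeta>\<^sub>k\<close>.

  If \<open>\<alpha> + \<beta> < 1\<close>, the second Borel-Cantelli lemma yields infinitely many \<open>k\<close> with a jump larger than any
  multiple of \<open>k\<close>, so the partial sums of the jumps are superlinear in absolute value infinitely often.
  By symmetry of the law of the jumps and Kolmogorov's 0-1 law they are superlinear upwards, hence
  \<open>V n \<ge> 0\<close> infinitely often, whatever the drift.

  If \<open>\<alpha> + \<beta> > 1\<close>, choose \<open>\<gamma> < \<alpha>\<close> with \<open>\<beta> + \<gamma> > 1\<close>. The jumps have finite \<open>\<gamma>\<close>-th absolute moment, so
  the \<open>\<gamma>\<close>-th powers of the absolute jumps divided by \<open>k\<close> have a summable expectation; since \<open>\<gamma> < 1\<close>, the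
  quotients themselves are almost surely summable, and by Kronecker's lemma the jumps contribute only \<open>o(n)\<close>.
  Thus \<open>V n / n\<close> converges to the slope of the drift.\<close>

section \<open>Avoiding a state\<close>

text \<open>First-step recursion for the probability that the chain from \<open>k\<close> is off
  \<open>j\<close> at all times 0, ..., \<open>n\<close>. Time 0 counts, hence the value 0 at
  \<open>j\<close>.\<close>

primrec avoid_prob :: "('s \<Rightarrow> 's pmf) \<Rightarrow> 's \<Rightarrow> nat \<Rightarrow> 's \<Rightarrow> ennreal" where
  "avoid_prob K j 0 k = indicator (- {j}) k"
| "avoid_prob K j (Suc n) k = indicator (- {j}) k * (\<integral>\<^sup>+l. avoid_prob K j n l \<partial>measure_pmf (K k))"

lemma measurable_chain_law_coordinate [measurable]:
  "(\<lambda>x. x t) \<in> measurable (chain_law K i) (count_space UNIV)"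
proof -
  have "(\<lambda>x. x t) \<in> measurable (\<Pi>\<^sub>M t\<in>UNIV. count_space UNIV) (count_space UNIV)"
    by (rule measurable_component_singleton) simp
  then show ?thesis
    by (simp add: measurable_cong_sets[OF sets_chain_law refl])
qed

lemma sets_chain_law_prefix_avoid:
  "{x. (\<forall>t\<le>m. x t = y t) \<and> (\<forall>t\<le>n. x (m + t) \<noteq> j)} \<in> sets (chain_law K i)"
proof -
  have "{x \<in> space (chain_law K i). (\<forall>t\<in>{..m}. x t = y t) \<and> (\<forall>t\<in>{..n}. x (m + t) \<noteq> j)}
      \<in> sets (chain_law K i)"
    by measurable
  then show ?thesis by (simp add: Ball_def)
qed

text \<open>The Markov property for avoidance events. In the induction on \<open>n\<close>,
  splitting by the state at time \<open>m + 1\<close> makes the prescribed prefix one step longer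
  and the remaining horizon one step shorter, so \<open>m\<close> and \<open>y\<close> must
  vary.\<close>

lemma emeasure_chain_law_prefix_avoid:
  fixes K :: "'s::countable \<Rightarrow> 's pmf"
  shows "emeasure (chain_law K i) {x. (\<forall>t\<le>m. x t = y t) \<and> (\<forall>t\<le>n. x (m + t) \<noteq> j)} =
    emeasure (chain_law K i) {x. \<forall>t\<le>m. x t = y t} * avoid_prob K j n (y m)"
proof (induction n arbitrary: m y)
  case 0
  have "{x. (\<forall>t\<le>m. x t = y t) \<and> x m \<noteq> j} = (if y m = j then {} else {x. \<forall>t\<le>m. x t = y t})"
    by auto
  then show ?case by simp
next
  case (Suc n)
  show ?case
  proof (cases "y m = j")
    case True
    then have "{x. (\<forall>t\<le>m. x t = y t) \<and> (\<forall>t\<le>Suc n. x (m + t) \<noteq> j)} = {}"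
      by fastforce
    then show ?thesis by (simp only: emeasure_empty) (simp add: True)
  next
    case False
    let ?y = "\<lambda>k. y(Suc m := k)"
    let ?S = "\<lambda>k. {x. (\<forall>t\<le>Suc m. x t = ?y k t) \<and> (\<forall>t\<le>n. x (Suc m + t) \<noteq> j)}"
    have path: "emeasure (chain_law K i) {x. \<forall>t\<le>Suc m. x t = ?y k t} =
        emeasure (chain_law K i) {x. \<forall>t\<le>m. x t = y t} * pmf (K (y m)) k" for k
      unfolding emeasure_chain_law_path by (auto simp: ennreal_mult'')
    have "{x. (\<forall>t\<le>m. x t = y t) \<and> (\<forall>t\<le>Suc n. x (m + t) \<noteq> j)} = (\<Union>k. ?S k)"
    proof (intro set_eqI iffI)
      fix x assume *: "x \<in> {x. (\<forall>t\<le>m. x t = y t) \<and> (\<forall>t\<le>Suc n. x (m + t) \<noteq> j)}"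
      then have "x (Suc m + t) \<noteq> j" if "t \<le> n" for t
        using that by (auto dest!: spec[of _ "Suc t"])
      with * have "x \<in> ?S (x (Suc m))"
        by (auto simp: le_Suc_eq)
      then show "x \<in> (\<Union>k. ?S k)" by blast
    next
      fix x assume "x \<in> (\<Union>k. ?S k)"
      then obtain k where *: "x \<in> ?S k" by blast
      then have "x m = y m" by auto
      have "x (m + t) \<noteq> j" if "t \<le> Suc n" for t
        using * False that \<open>x m = y m\<close> by (cases t) auto
      then show "x \<in> {x. (\<forall>t\<le>m. x t = y t) \<and> (\<forall>t\<le>Suc n. x (m + t) \<noteq> j)}"
        using * by auto
    qed
    then have "emeasure (chain_law K i) {x. (\<forall>t\<le>m. x t = y t) \<and> (\<forall>t\<le>Suc n. x (m + t) \<noteq> j)} =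
        (\<integral>\<^sup>+k. emeasure (chain_law K i) (?S k) \<partial>count_space UNIV)"
      using sets_chain_law_prefix_avoid[of "Suc m" _ n j K i]
      by (simp only:, intro emeasure_UN_countable) (auto simp: disjoint_family_on_def)
    also have "\<dots> = (\<integral>\<^sup>+k. emeasure (chain_law K i) {x. \<forall>t\<le>m. x t = y t} *
        (ennreal (pmf (K (y m)) k) * avoid_prob K j n k) \<partial>count_space UNIV)"
      by (simp only: Suc path) (simp add: mult.assoc)
    also have "\<dots> = emeasure (chain_law K i) {x. \<forall>t\<le>m. x t = y t} * avoid_prob K j (Suc n) (y m)"
      using False by (simp add: nn_integral_cmult nn_integral_measure_pmf)
    finally show ?thesis .
  qed
qed

text \<open>Since \<open>avoid_prob K i\<close> vanishes at \<open>i\<close> itself, a return is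
  described by conditioning on the state at time 1 and avoiding \<open>i\<close> from there.\<close>

lemma emeasure_chain_law_no_return:
  fixes K :: "'s::countable \<Rightarrow> 's pmf"
  shows "emeasure (chain_law K i) {x. \<forall>t\<le>n. x (Suc t) \<noteq> i} =
    (\<integral>\<^sup>+k. avoid_prob K i n k \<partial>measure_pmf (K i))"
proof -
  interpret prob_space "chain_law K i" by (rule prob_space_chain_law)
  let ?y = "\<lambda>k. (\<lambda>_. i)(Suc 0 := k)"
  let ?S = "\<lambda>k. {x. (\<forall>t\<le>Suc 0. x t = ?y k t) \<and> (\<forall>t\<le>n. x (Suc 0 + t) \<noteq> i)}"
  \<comment> \<open>The sets \<open>?S k\<close> prescribe \<open>x 0 = i\<close>, the no-return
    event does not; they match only up to a null set.\<close>
  have "emeasure (chain_law K i) {x. \<forall>t\<le>0. x t = i} = 1"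
    by (subst emeasure_chain_law_path) simp
  then have "AE x in chain_law K i. x 0 = i"
    using measurable_chain_law_coordinate[of 0 K i, THEN measurable_sets, of "{i}"]
    by (intro AE_I_eq_1) (simp_all add: vimage_def)
  then have "emeasure (chain_law K i) {x. \<forall>t\<le>n. x (Suc t) \<noteq> i} =
      emeasure (chain_law K i) (\<Union>k. ?S k)"
  proof (intro emeasure_eq_AE)
    show "{x. \<forall>t\<le>n. x (Suc t) \<noteq> i} \<in> sets (chain_law K i)"
    proof -
      have "{x \<in> space (chain_law K i). \<forall>t\<in>{..n}. x (Suc t) \<noteq> i} \<in> sets (chain_law K i)"
        by measurable
      then show ?thesis by (simp add: Ball_def)
    qed
    show "(\<Union>k. ?S k) \<in> sets (chain_law K i)"
      by (intro sets.countable_UN'' countableI_type sets_chain_law_prefix_avoid)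
  qed (auto simp: le_Suc_eq elim!: eventually_mono)
  also have "\<dots> = (\<integral>\<^sup>+k. emeasure (chain_law K i) (?S k) \<partial>count_space UNIV)"
    using sets_chain_law_prefix_avoid[of "Suc 0" _ n i K i]
    by (intro emeasure_UN_countable) (auto simp: disjoint_family_on_def)
  also have "\<dots> = (\<integral>\<^sup>+k. ennreal (pmf (K i) k) * avoid_prob K i n k \<partial>count_space UNIV)"
    by (simp only: emeasure_chain_law_prefix_avoid) (subst emeasure_chain_law_path, simp)
  finally show ?thesis by (simp add: nn_integral_measure_pmf)
qed

lemma no_return_tendsto:
  fixes K :: "'s::countable \<Rightarrow> 's pmf"
  shows "(\<lambda>n. \<integral>\<^sup>+k. avoid_prob K i n k \<partial>measure_pmf (K i)) \<longlonglongrightarrow> ennreal (1 - return_prob K i)"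
proof -
  interpret prob_space "chain_law K i" by (rule prob_space_chain_law)
  have sets: "{x. \<forall>t\<le>n. x (Suc t) \<noteq> i} \<in> events" for n
  proof -
    have "{x \<in> space (chain_law K i). \<forall>t\<in>{..n}. x (Suc t) \<noteq> i} \<in> events"
      by measurable
    then show ?thesis by (simp add: Ball_def)
  qed
  have ret: "{x. \<exists>t\<ge>1. x t = i} \<in> events"
  proof -
    have "{x \<in> space (chain_law K i). \<exists>t\<in>{1..}. x t = i} \<in> events"
      by measurable
    then show ?thesis by (simp add: Bex_def)
  qed
  have "(\<lambda>n. emeasure (chain_law K i) {x. \<forall>t\<le>n. x (Suc t) \<noteq> i})
      \<longlonglongrightarrow> emeasure (chain_law K i) (\<Inter>n. {x. \<forall>t\<le>n. x (Suc t) \<noteq> i})"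
    using sets by (intro Lim_emeasure_decseq) (auto simp: decseq_def intro: order_trans)
  also have "(\<Inter>n. {x. \<forall>t\<le>n. x (Suc t) \<noteq> i}) = space (chain_law K i) - {x. \<exists>t\<ge>1. x t = i}"
    by (auto dest!: gr0_implies_Suc simp: Suc_le_eq)
  also have "emeasure (chain_law K i) \<dots> = ennreal (1 - return_prob K i)"
    using ret by (simp only: emeasure_eq_measure prob_compl return_prob_def)
  finally show ?thesis by (simp add: emeasure_chain_law_no_return)
qed

section \<open>Recurrence and transience of walks on the half-line\<close>

text \<open>Real-valued form of \<open>avoid_prob\<close> for \<open>walk_kernel p\<close>. At
  \<open>k = 0\<close> the truncated \<open>k - 1\<close> is 0, which is the holding step.\<close>

primrec walk_avoid :: "(nat \<Rightarrow> real) \<Rightarrow> nat \<Rightarrow> nat \<Rightarrow> nat \<Rightarrow> real" where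
  "walk_avoid p j 0 k = (if k = j then 0 else 1)"
| "walk_avoid p j (Suc n) k =
    (if k = j then 0 else p k * walk_avoid p j n (k - 1) + (1 - p k) * walk_avoid p j n (k + 1))"

locale walk =
  fixes p :: "nat \<Rightarrow> real"
  assumes p: "p n \<in> {0<..<1}"
begin

lemma walk_avoid_nonneg: "0 \<le> walk_avoid p j n k"
  using p by (induction n arbitrary: k) (auto simp: less_imp_le intro!: add_nonneg_nonneg mult_nonneg_nonneg)

lemma walk_avoid_le_1: "walk_avoid p j n k \<le> 1"
proof (induction n arbitrary: k)
  case (Suc n)
  have "p k * walk_avoid p j n (k - 1) + (1 - p k) * walk_avoid p j n (k + 1) \<le> p k * 1 + (1 - p k) * 1"
    using Suc p[of k] by (intro add_mono mult_left_mono) auto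
  then show ?case by simp
qed simp

lemma walk_avoid_Suc_le: "walk_avoid p j (Suc n) k \<le> walk_avoid p j n k"
proof (induction n arbitrary: k)
  case 0
  show ?case using p[of k] by (auto simp: algebra_simps)
next
  case (Suc n)
  have "p k * walk_avoid p j (Suc n) (k - 1) + (1 - p k) * walk_avoid p j (Suc n) (k + 1) \<le>
      p k * walk_avoid p j n (k - 1) + (1 - p k) * walk_avoid p j n (k + 1)"
    using Suc p[of k] by (intro add_mono mult_left_mono) auto
  then show ?case by (simp only: walk_avoid.simps) simp
qed

lemma nn_integral_walk_kernel:
  assumes "\<And>l. f l = ennreal (g l)" "\<And>l. 0 \<le> g l"
  shows "(\<integral>\<^sup>+l. f l \<partial>measure_pmf (walk_kernel p k)) = ennreal (p k * g (k - 1) + (1 - p k) * g (k + 1))"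
proof -
  have "(\<integral>\<^sup>+l. f l \<partial>measure_pmf (walk_kernel p k)) =
      ennreal (g (k - 1)) * ennreal (p k) + ennreal (g (k + 1)) * ennreal (1 - p k)"
    using p[of k] unfolding walk_kernel_def by (simp add: assms(1))
  also have "\<dots> = ennreal (p k * g (k - 1) + (1 - p k) * g (k + 1))"
    using p[of k] assms(2) by (simp add: ennreal_mult'' ennreal_plus mult.commute)
  finally show ?thesis .
qed

lemma avoid_prob_walk_kernel: "avoid_prob (walk_kernel p) j n k = ennreal (walk_avoid p j n k)"
proof (induction n arbitrary: k)
  case (Suc n)
  show ?case
    using nn_integral_walk_kernel[OF Suc walk_avoid_nonneg] by (simp add: indicator_def)
qed (simp add: indicator_def)

section \<open>Probabilities of never hitting a state, as limits over the horizon\<close>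

definition escape :: "nat \<Rightarrow> nat \<Rightarrow> real" where
  "escape j k = lim (\<lambda>n. walk_avoid p j n k)"

lemma escape_tendsto: "(\<lambda>n. walk_avoid p j n k) \<longlonglongrightarrow> escape j k"
proof -
  have "decseq (\<lambda>n. walk_avoid p j n k)"
    by (intro decseq_SucI walk_avoid_Suc_le)
  then have "convergent (\<lambda>n. walk_avoid p j n k)"
    by (rule decseq_convergent[of _ 0]) (auto intro: walk_avoid_nonneg convergentI)
  then show ?thesis unfolding escape_def by (simp add: convergent_LIMSEQ_iff)
qed

lemma escape_bounds: "0 \<le> escape j k" "escape j k \<le> 1"
  using escape_tendsto[of j k] walk_avoid_nonneg[of j _ k] walk_avoid_le_1[of j _ k]
  by (auto intro: LIMSEQ_le_const LIMSEQ_le_const2)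

lemma escape_self: "escape j j = 0"
proof -
  have "walk_avoid p j n j = 0" for n by (cases n) auto
  then show ?thesis by (simp add: escape_def)
qed

lemma escape_harmonic:
  assumes "k \<noteq> j"
  shows "escape j k = p k * escape j (k - 1) + (1 - p k) * escape j (k + 1)"
proof (rule LIMSEQ_unique)
  show "(\<lambda>n. walk_avoid p j (Suc n) k) \<longlonglongrightarrow> escape j k"
    by (rule LIMSEQ_Suc[OF escape_tendsto])
  show "(\<lambda>n. walk_avoid p j (Suc n) k) \<longlonglongrightarrow> p k * escape j (k - 1) + (1 - p k) * escape j (k + 1)"
    using assms by (simp, intro tendsto_intros escape_tendsto)
qed

text \<open>Not returning means moving to a neighbour and never hitting \<open>i\<close> from there.
  For \<open>i = 0\<close> the lower neighbour is 0 itself, where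
  \<open>escape 0 0 = 0\<close>.\<close>

lemma one_minus_return_prob:
  "1 - return_prob (walk_kernel p) i = p i * escape i (i - 1) + (1 - p i) * escape i (i + 1)"
proof -
  interpret prob_space "chain_law (walk_kernel p) i" by (rule prob_space_chain_law)
  have "(\<lambda>n. ennreal (p i * walk_avoid p i n (i - 1) + (1 - p i) * walk_avoid p i n (i + 1)))
      \<longlonglongrightarrow> ennreal (1 - return_prob (walk_kernel p) i)"
    using no_return_tendsto[of "walk_kernel p" i]
    by (simp add: nn_integral_walk_kernel[OF avoid_prob_walk_kernel walk_avoid_nonneg])
  moreover have "(\<lambda>n. ennreal (p i * walk_avoid p i n (i - 1) + (1 - p i) * walk_avoid p i n (i + 1)))
      \<longlonglongrightarrow> ennreal (p i * escape i (i - 1) + (1 - p i) * escape i (i + 1))"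
    by (intro tendsto_intros escape_tendsto)
  ultimately have "ennreal (1 - return_prob (walk_kernel p) i) =
      ennreal (p i * escape i (i - 1) + (1 - p i) * escape i (i + 1))"
    by (rule LIMSEQ_unique)
  then show ?thesis
    using p[of i] escape_bounds(1) prob_le_1
    by (subst (asm) ennreal_inj) (auto simp: return_prob_def intro!: add_nonneg_nonneg mult_nonneg_nonneg)
qed

section \<open>Edge resistances and the summability criterion\<close>

definition weight :: "nat \<Rightarrow> real" where
  "weight n = (\<Prod>k=1..n. p k / (1 - p k))"

lemma weight_pos: "0 < weight n"
  unfolding weight_def using p by (intro prod_pos) auto

lemma weight_Suc: "weight (Suc n) = weight n * (p (Suc n) / (1 - p (Suc n)))"
  by (simp add: weight_def)

text \<open>At 0 the down-step is a holding step, so harmonicity there forces the first increment of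
  \<open>escape j\<close> to vanish. Harmonicity carries this upwards: \<open>escape j\<close> is
  constant up to \<open>j\<close>, where it is 0.\<close>

lemma escape_below:
  assumes "k \<le> j"
  shows "escape j k = 0"
proof -
  have step: "escape j (Suc l) = escape j l" if "l < j" for l
    using that
  proof (induction l)
    case 0
    then have "(1 - p 0) * (escape j (Suc 0) - escape j 0) = 0"
      using escape_harmonic[of 0 j] by (simp add: algebra_simps)
    then show ?case using p[of 0] by simp
  next
    case (Suc l)
    then have "(1 - p (Suc l)) * (escape j (Suc (Suc l)) - escape j (Suc l)) = 0"
      using escape_harmonic[of "Suc l" j] by (simp add: algebra_simps)
    then show ?case using p[of "Suc l"] by simp
  qed
  show ?thesis
    using assms by (induction rule: inc_induct) (auto simp: escape_self step)
qed

text \<open>Harmonicity at \<open>k\<close> says that \<open>1 - p k\<close> times the upper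
  increment equals \<open>p k\<close> times the lower one, so increments get multiplied by the odds
  \<open>p k / (1 - p k)\<close>. In network terms \<open>weight n\<close> is the resistance of the
  edge from \<open>n\<close> to \<open>n + 1\<close>, with \<open>weight 0 = 1\<close>.\<close>

lemma escape_increment:
  "escape j (Suc (j + m)) - escape j (j + m) = weight (j + m) / weight j * escape j (Suc j)"
proof (induction m)
  case 0
  show ?case using weight_pos[of j] by (simp add: escape_self)
next
  case (Suc m)
  let ?k = "Suc (j + m)"
  have "(1 - p ?k) * (escape j (Suc ?k) - escape j ?k) = p ?k * (escape j ?k - escape j (j + m))"
    using escape_harmonic[of ?k j] by (simp add: algebra_simps)
  then have "escape j (Suc ?k) - escape j ?k = p ?k / (1 - p ?k) * (escape j ?k - escape j (j + m))"
    using p[of ?k] by (simp add: field_simps)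
  then show ?case by (simp add: Suc weight_Suc)
qed

lemma escape_above:
  "escape j (j + m) = (\<Sum>l<m. weight (j + l)) / weight j * escape j (Suc j)"
proof (induction m)
  case (Suc m)
  then show ?case
    using escape_increment[of j m] by (simp add: add_divide_distrib algebra_simps)
qed (simp add: escape_self)

text \<open>By \<open>escape_above\<close>, a positive \<open>escape j (Suc j)\<close> together with
  \<open>escape j k \<le> 1\<close> would bound the partial sums of the weights.\<close>

lemma recurrent_if_not_summable:
  assumes "\<not> summable weight"
  shows "recurrent_chain (walk_kernel p)"
  unfolding recurrent_chain_def
proof
  fix j
  have "escape j (Suc j) = 0"
  proof (rule ccontr)
    assume "escape j (Suc j) \<noteq> 0"
    then have pos: "escape j (Suc j) > 0"
      using escape_bounds(1)[of j "Suc j"] by simp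
    have "(\<Sum>l<m. weight (j + l)) \<le> weight j / escape j (Suc j)" for m
      using escape_bounds(2)[of j "j + m"] pos weight_pos[of j]
      by (simp add: escape_above field_simps)
    then have "summable (\<lambda>l. weight (j + l))"
      using weight_pos by (intro summableI_nonneg_bounded) (auto intro: less_imp_le)
    then show False
      using assms summable_iff_shift[of weight j] by (simp add: add.commute)
  qed
  then show "return_prob (walk_kernel p) j = 1"
    using one_minus_return_prob[of j] escape_below[of "j - 1" j] by simp
qed

text \<open>When the weights are summable, the normalised partial sums are a harmonic minorant of all
  the finite-time avoidance probabilities.\<close>

lemma transient_if_summable:
  assumes "summable weight"
  shows "transient_chain (walk_kernel p)"
  unfolding transient_chain_def
proof
  fix j
  have summable: "summable (\<lambda>l. weight (j + l))"
    using assms summable_iff_shift[of weight j] by (simp add: add.commute)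
  define W where "W = (\<Sum>l. weight (j + l))"
  have partial_le: "(\<Sum>l<m. weight (j + l)) \<le> W" for m
    unfolding W_def using summable weight_pos by (intro sum_le_suminf) (auto intro: less_imp_le)
  have "W > 0"
    using partial_le[of 1] weight_pos[of j] by simp
  \<comment> \<open>Truncated subtraction makes \<open>h\<close> vanish on all of {0..j}; division
    by \<open>W\<close> keeps it at most 1.\<close>
  define h where "h k = (\<Sum>l<k - j. weight (j + l)) / W" for k
  have h_bounds: "0 \<le> h k" "h k \<le> 1" for k
    unfolding h_def using \<open>W > 0\<close> partial_le[of "k - j"] weight_pos
    by (auto intro!: divide_nonneg_nonneg sum_nonneg intro: less_imp_le)
  have h_le: "h k \<le> p k * h (k - 1) + (1 - p k) * h (k + 1)" if "k \<noteq> j" for k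
  proof (cases "k < j")
    case True
    then have "h k = 0" by (simp add: h_def)
    then show ?thesis
      using h_bounds(1) p[of k] by (auto intro!: add_nonneg_nonneg mult_nonneg_nonneg)
  next
    case False
    define m where "m = k - Suc j"
    have k: "k = Suc (j + m)"
      using False that by (simp add: m_def)
    define w where "w = weight (j + m)"
    have h_k: "h k = h (k - 1) + w / W" "h (k + 1) = h k + w * (p k / (1 - p k)) / W"
      unfolding h_def k w_def using weight_Suc[of "j + m"]
      by (simp_all add: Suc_diff_le add_divide_distrib)
    have "1 - p k \<noteq> 0"
      using p[of k] by simp
    then have "(1 - p k) * (w * (p k / (1 - p k)) / W) = p k * (w / W)"
      by simp
    then have "p k * h (k - 1) + (1 - p k) * h (k + 1) = h k"
      unfolding h_k(2) by (simp add: h_k(1) algebra_simps)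
    then show ?thesis by simp
  qed
  have h_j: "h j = 0" by (simp add: h_def)
  \<comment> \<open>Comparison by induction on the horizon: at horizon 0 the bounds
    \<open>h k \<le> 1\<close> and \<open>h j = 0\<close> suffice, and each further step averages
    both sides.\<close>
  have "h k \<le> walk_avoid p j n k" for n k
  proof (induction n arbitrary: k)
    case 0
    show ?case using h_bounds(2) h_j by simp
  next
    case (Suc n)
    have "p k * h (k - 1) + (1 - p k) * h (k + 1) \<le>
        p k * walk_avoid p j n (k - 1) + (1 - p k) * walk_avoid p j n (k + 1)"
      using Suc p[of k] by (intro add_mono mult_left_mono) auto
    then show ?case using h_le[of k] h_j by auto
  qed
  then have "h (Suc j) \<le> escape j (Suc j)"
    by (intro LIMSEQ_le_const[OF escape_tendsto]) auto
  moreover have "h (Suc j) > 0"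
    using weight_pos[of j] \<open>W > 0\<close> by (simp add: h_def)
  ultimately have "escape j (Suc j) > 0" by simp
  then have "p j * escape j (j - 1) + (1 - p j) * escape j (j + 1) > 0"
    using p[of j] escape_bounds(1) by (intro add_nonneg_pos mult_nonneg_nonneg) auto
  then show "return_prob (walk_kernel p) j < 1"
    using one_minus_return_prob[of j] by simp
qed

end

lemma (in walk) weight_eq_exp: "weight n = exp (\<Sum>k=1..n. ln (p k / (1 - p k)))"
proof -
  have "exp (\<Sum>k=1..n. ln (p k / (1 - p k))) = (\<Prod>k=1..n. exp (ln (p k / (1 - p k))))"
    by (simp add: exp_sum)
  also have "\<dots> = weight n"
    unfolding weight_def using p by (intro prod.cong) auto
  finally show ?thesis ..
qed

text \<open>A nonnegative potential means a weight of at least 1, and infinitely many such weights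
  prevent convergence to 0.\<close>

lemma (in walk) recurrent_if_frequently_nonneg:
  assumes "\<exists>\<^sub>F n in sequentially. 0 \<le> (\<Sum>k=1..n. ln (p k / (1 - p k)))"
  shows "recurrent_chain (walk_kernel p)"
proof (rule recurrent_if_not_summable, rule notI)
  assume "summable weight"
  then have "\<forall>\<^sub>F n in sequentially. weight n < 1"
    by (intro order_tendstoD(2)[OF summable_LIMSEQ_zero]) auto
  then have "\<forall>\<^sub>F n in sequentially. \<not> 0 \<le> (\<Sum>k=1..n. ln (p k / (1 - p k)))"
    by (rule eventually_mono) (simp add: weight_eq_exp)
  with assms show False
    unfolding frequently_def by blast
qed

lemma (in walk) transient_if_linear_drift:
  assumes "\<epsilon> > 0" and drift: "\<forall>\<^sub>F n in sequentially. (\<Sum>k=1..n. ln (p k / (1 - p k))) \<le> - \<epsilon> * real n"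
  shows "transient_chain (walk_kernel p)"
proof (rule transient_if_summable, rule summable_comparison_test_ev)
  show "summable (\<lambda>n. exp (- \<epsilon>) ^ n)"
    using \<open>\<epsilon> > 0\<close> by (intro summable_geometric) simp
  show "\<forall>\<^sub>F n in sequentially. norm (weight n) \<le> exp (- \<epsilon>) ^ n"
    using drift by eventually_elim (simp add: weight_eq_exp exp_of_nat_mult[symmetric] mult.commute)
qed

section \<open>Independent sequences\<close>

text \<open>Second Borel-Cantelli lemma, from the product rule and 1 - x \<le> exp (- x).\<close>

lemma (in prob_space) borel_cantelli_indep_vars:
  fixes X :: "nat \<Rightarrow> 'a \<Rightarrow> 'b"
  assumes indep: "indep_vars N X UNIV"
    and A: "\<And>n. A n \<in> sets (N n)"
    and not_summable: "\<not> summable (\<lambda>n. prob (X n -` A n \<inter> space M))"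
  shows "AE w in M. \<exists>\<^sub>F n in sequentially. X n w \<in> A n"
proof -
  have rv: "random_variable (N n) (X n)" for n
    using indep by (auto simp: indep_vars_def)
  have events: "X n -` A n \<inter> space M \<in> events" for n
    using rv A by (rule measurable_sets)
  have "AE w in M. \<exists>n\<ge>m. X n w \<in> A n" for m
  proof -
    define B where "B = space M - (\<Union>n\<in>{m..}. X n -` A n \<inter> space M)"
    have B: "B \<in> events"
      unfolding B_def using events by (intro sets.compl_sets sets.countable_UN') auto
    have "prob B = 0"
    proof (rule ccontr)
      assume "prob B \<noteq> 0"
      then have "prob B > 0"
        by (simp add: zero_less_measure_iff)
      have "\<not> summable (\<lambda>n. prob (X (n + m) -` A (n + m) \<inter> space M))"
        using not_summable by (subst summable_iff_shift)
      \<comment> \<open>The block of \<open>k\<close> indices is so long that missing every event in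
        it has probability below \<open>prob B\<close>, although \<open>B\<close> implies exactly
        this.\<close>
      then obtain k where k: "(\<Sum>n<k. prob (X (n + m) -` A (n + m) \<inter> space M)) > - ln (prob B)"
        by (meson measure_nonneg not_le summableI_nonneg_bounded)
      \<comment> \<open>The product rule and the finite intersection need a nonempty index set; the
        empty sum 0 cannot exceed \<open>- ln (prob B)\<close>, which is nonnegative.\<close>
      have "k > 0"
        using k \<open>prob B > 0\<close> prob_le_1[of B] by (intro Nat.gr0I) auto
      let ?I = "{m..<m + k}"
      have "prob B \<le> prob (\<Inter>n\<in>?I. X n -` (space (N n) - A n) \<inter> space M)"
        using \<open>k > 0\<close> measurable_space[OF rv] B A rv
        by (intro finite_measure_mono sets.finite_INT measurable_sets[OF rv]) (auto simp: B_def)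
      also have "\<dots> = (\<Prod>n\<in>?I. prob (X n -` (space (N n) - A n) \<inter> space M))"
        using \<open>k > 0\<close> A by (intro indep_varsD[OF indep]) auto
      also have "\<dots> = (\<Prod>n\<in>?I. 1 - prob (X n -` A n \<inter> space M))"
      proof (rule prod.cong)
        fix n
        have "X n -` (space (N n) - A n) \<inter> space M = space M - (X n -` A n \<inter> space M)"
          using measurable_space[OF rv] by auto
        then show "prob (X n -` (space (N n) - A n) \<inter> space M) = 1 - prob (X n -` A n \<inter> space M)"
          using events by (simp add: prob_compl)
      qed simp
      also have "\<dots> \<le> (\<Prod>n\<in>?I. exp (- prob (X n -` A n \<inter> space M)))"
      proof (rule prod_mono)
        fix n
        show "0 \<le> 1 - prob (X n -` A n \<inter> space M) \<and>
            1 - prob (X n -` A n \<inter> space M) \<le> exp (- prob (X n -` A n \<inter> space M))"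
          using exp_ge_add_one_self[of "- prob (X n -` A n \<inter> space M)"] by simp
      qed
      also have "\<dots> = exp (- (\<Sum>n\<in>?I. prob (X n -` A n \<inter> space M)))"
        by (simp add: exp_sum sum_negf[symmetric])
      also have "(\<Sum>n\<in>?I. prob (X n -` A n \<inter> space M)) =
          (\<Sum>n<k. prob (X (n + m) -` A (n + m) \<inter> space M))"
        using sum.shift_bounds_nat_ivl[of "\<lambda>n. prob (X n -` A n \<inter> space M)" 0 m k]
        by (simp add: add.commute atLeast0LessThan)
      also have "exp (- \<dots>) < exp (ln (prob B))"
        using k by simp
      finally show False
        using \<open>prob B > 0\<close> by simp
    qed
    then have "AE w in M. w \<notin> B"
      using B by (simp add: prob_eq_0)
    then show ?thesis
      by (rule AE_mp) (auto simp: B_def intro!: AE_I2)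
  qed
  then have "AE w in M. \<forall>m. \<exists>n\<ge>m. X n w \<in> A n"
    by (simp add: AE_all_countable)
  then show ?thesis
    by (simp add: frequently_sequentially)
qed

text \<open>Rectangle events form an intersection-stable generator of the \<sigma>-algebra of each
  pair, so the product rule need only be checked on them.\<close>

lemma (in prob_space) indep_vars_Pair:
  assumes X: "indep_vars S X UNIV" and Y: "indep_vars T Y UNIV"
    and XY: "indep_var (\<Pi>\<^sub>M n\<in>UNIV. S n) (\<lambda>w n. X n w) (\<Pi>\<^sub>M n\<in>UNIV. T n) (\<lambda>w n. Y n w)"
  shows "indep_vars (\<lambda>n. S n \<Otimes>\<^sub>M T n) (\<lambda>n w. (X n w, Y n w)) UNIV"
proof -
  have rvX: "random_variable (S n) (X n)" and rvY: "random_variable (T n) (Y n)" for n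
    using X Y by (auto simp: indep_vars_def)
  define G where "G n = {X n -` A \<inter> Y n -` B \<inter> space M | A B. A \<in> sets (S n) \<and> B \<in> sets (T n)}" for n
  have G_events: "G n \<subseteq> events" for n
  proof
    fix E assume "E \<in> G n"
    then obtain A B where "E = (X n -` A \<inter> space M) \<inter> (Y n -` B \<inter> space M)"
        "A \<in> sets (S n)" "B \<in> sets (T n)"
      unfolding G_def by auto
    then show "E \<in> events"
      using measurable_sets[OF rvX] measurable_sets[OF rvY] by auto
  qed
  \<comment> \<open>The event is the intersection of one cylinder for the sequence \<open>X\<close>
    and one for \<open>Y\<close>. Independence of the two sequences separates these; independence
    within each sequence then splits them into factors.\<close>
  have rect: "prob (\<Inter>j\<in>J. X j -` A j \<inter> Y j -` B j \<inter> space M) =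
      (\<Prod>j\<in>J. prob (X j -` A j \<inter> space M) * prob (Y j -` B j \<inter> space M))"
    if J: "finite J" "J \<noteq> {}" and AB: "\<And>j. j \<in> J \<Longrightarrow> A j \<in> sets (S j)" "\<And>j. j \<in> J \<Longrightarrow> B j \<in> sets (T j)"
    for J A B
  proof -
    let ?A = "{x \<in> space (\<Pi>\<^sub>M n\<in>UNIV. S n). \<forall>j\<in>J. x j \<in> A j}"
    let ?B = "{x \<in> space (\<Pi>\<^sub>M n\<in>UNIV. T n). \<forall>j\<in>J. x j \<in> B j}"
    have sets: "?A \<in> sets (\<Pi>\<^sub>M n\<in>UNIV. S n)" "?B \<in> sets (\<Pi>\<^sub>M n\<in>UNIV. T n)"
      using J AB by measurable
    have "(\<Inter>j\<in>J. X j -` A j \<inter> Y j -` B j \<inter> space M) =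
        ((\<lambda>w n. X n w) -` ?A \<inter> space M) \<inter> ((\<lambda>w n. Y n w) -` ?B \<inter> space M)"
      using J measurable_space[OF rvX] measurable_space[OF rvY] by (auto simp: space_PiM)
    also have "prob \<dots> = prob ((\<lambda>w n. X n w) -` ?A \<inter> space M) * prob ((\<lambda>w n. Y n w) -` ?B \<inter> space M)"
    proof (rule indep_setD[OF conjunct2[OF XY[unfolded indep_var_eq]]])
      show "(\<lambda>w n. X n w) -` ?A \<inter> space M \<in>
          sigma_sets (space M) {(\<lambda>w n. X n w) -` A \<inter> space M |A. A \<in> sets (\<Pi>\<^sub>M n\<in>UNIV. S n)}"
        using sets(1) by (intro sigma_sets.Basic) blast
      show "(\<lambda>w n. Y n w) -` ?B \<inter> space M \<in>
          sigma_sets (space M) {(\<lambda>w n. Y n w) -` A \<inter> space M |A. A \<in> sets (\<Pi>\<^sub>M n\<in>UNIV. T n)}"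
        using sets(2) by (intro sigma_sets.Basic) blast
    qed
    also have "(\<lambda>w n. X n w) -` ?A \<inter> space M = (\<Inter>j\<in>J. X j -` A j \<inter> space M)"
      using J measurable_space[OF rvX] by (auto simp: space_PiM)
    also have "(\<lambda>w n. Y n w) -` ?B \<inter> space M = (\<Inter>j\<in>J. Y j -` B j \<inter> space M)"
      using J measurable_space[OF rvY] by (auto simp: space_PiM)
    also have "prob (\<Inter>j\<in>J. X j -` A j \<inter> space M) = (\<Prod>j\<in>J. prob (X j -` A j \<inter> space M))"
      using J AB by (intro indep_varsD[OF X]) auto
    also have "prob (\<Inter>j\<in>J. Y j -` B j \<inter> space M) = (\<Prod>j\<in>J. prob (Y j -` B j \<inter> space M))"
      using J AB by (intro indep_varsD[OF Y]) auto
    finally show ?thesis by (simp add: prod.distrib)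
  qed
  have "indep_sets G UNIV"
  proof (rule indep_setsI)
    fix E J assume J: "J \<noteq> {}" "finite J" "\<forall>j\<in>J. E j \<in> G j"
    then have "\<forall>j\<in>J. \<exists>A B. E j = X j -` A \<inter> Y j -` B \<inter> space M \<and> A \<in> sets (S j) \<and> B \<in> sets (T j)"
      by (auto simp: G_def)
    then obtain A B where E: "\<And>j. j \<in> J \<Longrightarrow> E j = X j -` A j \<inter> Y j -` B j \<inter> space M"
      and AB: "\<And>j. j \<in> J \<Longrightarrow> A j \<in> sets (S j)" "\<And>j. j \<in> J \<Longrightarrow> B j \<in> sets (T j)"
      by metis
    have "prob (\<Inter>j\<in>J. E j) = prob (\<Inter>j\<in>J. X j -` A j \<inter> Y j -` B j \<inter> space M)"
      using E by simp
    also have "\<dots> = (\<Prod>j\<in>J. prob (X j -` A j \<inter> space M) * prob (Y j -` B j \<inter> space M))"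
      using J AB by (intro rect) auto
    also have "\<dots> = (\<Prod>j\<in>J. prob (E j))"
      \<comment> \<open>The singleton case of \<open>rect\<close> identifies each factor as
        \<open>prob (E j)\<close>.\<close>
      using rect[of "{j}" A B for j] AB E by (intro prod.cong) auto
    finally show "prob (\<Inter>j\<in>J. E j) = (\<Prod>j\<in>J. prob (E j))" .
  qed (rule G_events)
  moreover have "Int_stable (G n)" for n
  proof (rule Int_stableI)
    fix a b assume "a \<in> G n" "b \<in> G n"
    then obtain A B A' B' where "a = X n -` A \<inter> Y n -` B \<inter> space M" "b = X n -` A' \<inter> Y n -` B' \<inter> space M"
        "A \<in> sets (S n)" "B \<in> sets (T n)" "A' \<in> sets (S n)" "B' \<in> sets (T n)"
      by (auto simp: G_def)
    then show "a \<inter> b \<in> G n"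
      unfolding G_def by (intro CollectI exI[of _ "A \<inter> A'"] exI[of _ "B \<inter> B'"]) auto
  qed
  ultimately have G_indep: "indep_sets (\<lambda>n. sigma_sets (space M) (G n)) UNIV"
    by (intro indep_sets_sigma)
  show ?thesis
    unfolding indep_vars_def2
  proof (intro conjI ballI indep_sets_mono_sets[OF G_indep] subsetI)
    fix n show "random_variable (S n \<Otimes>\<^sub>M T n) (\<lambda>w. (X n w, Y n w))"
      using rvX rvY by (rule measurable_Pair)
  next
    fix n E assume "E \<in> {(\<lambda>w. (X n w, Y n w)) -` C \<inter> space M |C. C \<in> sets (S n \<Otimes>\<^sub>M T n)}"
    then obtain C where C: "E = (\<lambda>w. (X n w, Y n w)) -` C \<inter> space M" "C \<in> sets (S n \<Otimes>\<^sub>M T n)"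
      by blast
    have Pow: "G n \<subseteq> Pow (space M)"
      by (auto simp: G_def)
    \<comment> \<open>Both components are measurable for the \<sigma>-algebra generated by
      rectangles (take the whole space in the other slot), hence so is the pair.\<close>
    let ?N = "sigma (space M) (G n)"
    have "X n \<in> measurable ?N (S n)"
    proof (rule measurableI)
      fix A assume A: "A \<in> sets (S n)"
      have "X n -` A \<inter> space M = X n -` A \<inter> Y n -` space (T n) \<inter> space M"
        using measurable_space[OF rvY] by auto
      with A have "X n -` A \<inter> space M \<in> G n"
        unfolding G_def by auto
      then show "X n -` A \<inter> space ?N \<in> sets ?N"
        using Pow by (simp add: space_measure_of sets_measure_of)
    qed (use measurable_space[OF rvX] Pow in \<open>simp add: space_measure_of\<close>)
    moreover have "Y n \<in> measurable ?N (T n)"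
    proof (rule measurableI)
      fix A assume A: "A \<in> sets (T n)"
      have "Y n -` A \<inter> space M = X n -` space (S n) \<inter> Y n -` A \<inter> space M"
        using measurable_space[OF rvX] by auto
      with A have "Y n -` A \<inter> space M \<in> G n"
        unfolding G_def by auto
      then show "Y n -` A \<inter> space ?N \<in> sets ?N"
        using Pow by (simp add: space_measure_of sets_measure_of)
    qed (use measurable_space[OF rvY] Pow in \<open>simp add: space_measure_of\<close>)
    ultimately have "(\<lambda>w. (X n w, Y n w)) \<in> measurable ?N (S n \<Otimes>\<^sub>M T n)"
      by (rule measurable_Pair)
    from measurable_sets[OF this C(2)] show "E \<in> sigma_sets (space M) (G n)"
      using Pow C(1) by (simp add: space_measure_of sets_measure_of)
  qed
qed

section \<open>Superlinear partial sums\<close>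

definition superlinear_sums :: "(nat \<Rightarrow> real) \<Rightarrow> bool" where
  "superlinear_sums y \<longleftrightarrow> (\<forall>K::nat. \<exists>\<^sub>F n in sequentially. real K * real n < (\<Sum>k=1..n. y k))"

text \<open>A constant is eventually at most \<open>n\<close>, so passing from \<open>K\<close> to
  \<open>Suc K\<close> absorbs it.\<close>

lemma superlinear_add_const:
  fixes f g :: "nat \<Rightarrow> real"
  assumes f: "\<forall>K::nat. \<exists>\<^sub>F n in sequentially. real K * real n < f n"
    and g: "\<forall>\<^sub>F n in sequentially. f n \<le> g n + c"
  shows "\<forall>K::nat. \<exists>\<^sub>F n in sequentially. real K * real n < g n"
proof
  fix K :: nat
  have "\<forall>\<^sub>F n in sequentially. c \<le> real n"
    by (rule eventually_compose_filterlim[OF eventually_ge_at_top filterlim_real_sequentially])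
  with g have "\<forall>\<^sub>F n in sequentially. f n \<le> g n + c \<and> c \<le> real n"
    by (rule eventually_conj)
  moreover have "\<exists>\<^sub>F n in sequentially. real (Suc K) * real n < f n"
    using f by blast
  ultimately have "\<exists>\<^sub>F n in sequentially. real (Suc K) * real n < f n \<and> f n \<le> g n + c \<and> c \<le> real n"
    by (rule frequently_eventually_frequently[rotated])
  then show "\<exists>\<^sub>F n in sequentially. real K * real n < g n"
    by (rule frequently_elim1) (auto simp: algebra_simps)
qed

text \<open>Dropping the first \<open>m\<close> terms shifts the sums by a constant; this is what
  makes the property a tail event.\<close>

lemma superlinear_sums_tail:
  "superlinear_sums y \<longleftrightarrow> (\<forall>K::nat. \<exists>\<^sub>F n in sequentially. real K * real n < (\<Sum>k=Suc m..n. y k))"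
proof -
  define c where "c = (\<Sum>k=1..m. y k)"
  have "(\<Sum>k=1..n. y k) = c + (\<Sum>k=Suc m..n. y k)" if "m \<le> n" for n
  proof -
    have "{1..n} = {1..m} \<union> {Suc m..n}"
      using that by auto
    then show ?thesis
      unfolding c_def by (simp add: sum.union_disjoint)
  qed
  then have eq: "\<forall>\<^sub>F n in sequentially. (\<Sum>k=1..n. y k) = c + (\<Sum>k=Suc m..n. y k)"
    by (intro eventually_mono[OF eventually_ge_at_top[of m]])
  show ?thesis
    unfolding superlinear_sums_def
  proof
    assume "\<forall>K::nat. \<exists>\<^sub>F n in sequentially. real K * real n < (\<Sum>k=1..n. y k)"
    then show "\<forall>K::nat. \<exists>\<^sub>F n in sequentially. real K * real n < (\<Sum>k=Suc m..n. y k)"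
      by (rule superlinear_add_const[where c=c]) (use eq in \<open>auto elim: eventually_mono\<close>)
  next
    assume "\<forall>K::nat. \<exists>\<^sub>F n in sequentially. real K * real n < (\<Sum>k=Suc m..n. y k)"
    then show "\<forall>K::nat. \<exists>\<^sub>F n in sequentially. real K * real n < (\<Sum>k=1..n. y k)"
      by (rule superlinear_add_const[where c="- c"]) (use eq in \<open>auto elim: eventually_mono\<close>)
  qed
qed

text \<open>If both alternatives fail, the partial sums are O(n) in absolute value, and so are the
  terms, being differences of consecutive partial sums.\<close>

lemma superlinear_sums_or_uminus:
  fixes y :: "nat \<Rightarrow> real"
  assumes "\<And>K::nat. \<exists>\<^sub>F n in sequentially. real K * real n \<le> \<bar>y n\<bar>"
  shows "superlinear_sums y \<or> superlinear_sums (\<lambda>k. - y k)"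
proof (rule ccontr)
  let ?S = "\<lambda>n. \<Sum>k=1..n. y k"
  assume "\<not> ?thesis"
  then obtain K L :: nat where K: "\<forall>\<^sub>F n in sequentially. ?S n \<le> real K * real n"
    and L: "\<forall>\<^sub>F n in sequentially. - ?S n \<le> real L * real n"
    by (auto simp: superlinear_sums_def frequently_def not_less sum_negf)
  define C where "C = max K L"
  have "\<forall>\<^sub>F n in sequentially. \<bar>?S n\<bar> \<le> real C * real n"
    using K L
  proof eventually_elim
    case (elim n)
    have "real K * real n \<le> real C * real n" "real L * real n \<le> real C * real n"
      by (auto simp: C_def intro!: mult_right_mono)
    with elim show ?case by linarith
  qed
  then have "\<forall>\<^sub>F n in sequentially. \<bar>?S n\<bar> \<le> real C * real n \<and> \<bar>?S (Suc n)\<bar> \<le> real C * real (Suc n)"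
    by (intro eventually_conj eventually_sequentially_Suc[THEN iffD2])
  then have "\<forall>\<^sub>F n in sequentially. \<bar>y (Suc n)\<bar> < real (2 * C + 1) * real (Suc n)"
  proof (rule eventually_mono)
    fix n assume *: "\<bar>?S n\<bar> \<le> real C * real n \<and> \<bar>?S (Suc n)\<bar> \<le> real C * real (Suc n)"
    have "y (Suc n) = ?S (Suc n) - ?S n"
      by simp
    with * have "\<bar>y (Suc n)\<bar> \<le> real C * real n + real C * real (Suc n)"
      by linarith
    \<comment> \<open>The additional 1 in \<open>2 * C + 1\<close> gives strictness, also for
      \<open>C = 0\<close>.\<close>
    also have "\<dots> < real (2 * C + 1) * real (Suc n)"
      by (simp add: algebra_simps)
    finally show "\<bar>y (Suc n)\<bar> < real (2 * C + 1) * real (Suc n)" .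
  qed
  then have "\<forall>\<^sub>F n in sequentially. \<bar>y n\<bar> < real (2 * C + 1) * real n"
    by (subst eventually_sequentially_Suc[symmetric])
  with assms[of "2 * C + 1"] show False
    unfolding frequently_def not_le by blast
qed

text \<open>Since \<open>K\<close> ranges over the naturals, only countably many events are
  combined. Measurability is assumed only beyond \<open>m\<close>, so that \<open>N\<close> may be
  the \<sigma>-algebra generated by the later variables.\<close>

lemma measurable_superlinear_sums:
  assumes "\<And>k. k > m \<Longrightarrow> y k \<in> borel_measurable N"
  shows "{w \<in> space N. \<forall>K::nat. \<exists>\<^sub>F n in sequentially. real K * real n < (\<Sum>k=Suc m..n. y k w)} \<in> sets N"
proof -
  have "(\<lambda>w. \<Sum>k=Suc m..n. y k w) \<in> borel_measurable N" for n
    using assms by (intro borel_measurable_sum) auto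
  note [measurable] = this
  show ?thesis
    unfolding frequently_sequentially by measurable
qed

text \<open>The symmetry makes the upward and the downward event equally likely; as one of them must
  occur, neither is null, and the upward one is a tail event.\<close>

lemma (in prob_space) AE_superlinear_sums:
  fixes Y :: "nat \<Rightarrow> 'a \<Rightarrow> real"
  assumes indep: "indep_vars (\<lambda>_. borel) Y UNIV"
    and symmetric: "\<And>n. distr M borel (\<lambda>w. - Y n w) = distr M borel (Y n)"
    and large: "\<And>K::nat. AE w in M. \<exists>\<^sub>F n in sequentially. real K * real n \<le> \<bar>Y n w\<bar>"
  shows "AE w in M. superlinear_sums (\<lambda>n. Y n w)"
proof -
  have rv [measurable]: "random_variable borel (Y n)" for n
    using indep by (auto simp: indep_vars_def)
  define P :: "(nat \<Rightarrow> real) measure" where "P = (\<Pi>\<^sub>M n\<in>UNIV. borel)"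
  define E where "E = {w \<in> space M. superlinear_sums (\<lambda>n. Y n w)}"
  define E' where "E' = {w \<in> space M. superlinear_sums (\<lambda>n. - Y n w)}"
  have "indep_vars (\<lambda>_. borel) (\<lambda>n w. - Y n w) UNIV"
    by (rule indep_vars_compose2[OF indep]) simp
  \<comment> \<open>By independence both sequence laws are products of their marginals, which agree
    by symmetry.\<close>
  then have "distr M P (\<lambda>w n. - Y n w) = (\<Pi>\<^sub>M n\<in>UNIV. distr M borel (\<lambda>w. - Y n w))"
    using indep_vars_iff_distr_eq_PiM[of UNIV "\<lambda>n w. - Y n w" "\<lambda>_. borel"] by (simp add: P_def restrict_def)
  also have "\<dots> = distr M P (\<lambda>w n. Y n w)"
    using indep_vars_iff_distr_eq_PiM[of UNIV Y "\<lambda>_. borel"] indep by (simp add: P_def symmetric restrict_def)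
  finally have distr_eq: "distr M P (\<lambda>w n. - Y n w) = distr M P (\<lambda>w n. Y n w)" .
  have "{x \<in> space P. superlinear_sums x} \<in> sets P"
    using measurable_superlinear_sums[of 0 "\<lambda>k x. x k" P]
    by (simp add: superlinear_sums_tail[of _ 0] P_def)
  moreover have meas: "(\<lambda>w n. Y n w) \<in> measurable M P" "(\<lambda>w n. - Y n w) \<in> measurable M P"
    unfolding P_def by (auto intro!: measurable_PiM_single')
  moreover have "measure (distr M P (\<lambda>w n. Y n w)) {x \<in> space P. superlinear_sums x} =
      measure (distr M P (\<lambda>w n. - Y n w)) {x \<in> space P. superlinear_sums x}"
    by (simp only: distr_eq)
  moreover have "(\<lambda>w n. Y n w) -` {x \<in> space P. superlinear_sums x} \<inter> space M = E"
    "(\<lambda>w n. - Y n w) -` {x \<in> space P. superlinear_sums x} \<inter> space M = E'"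
    using measurable_space[OF meas(1)] measurable_space[OF meas(2)] by (auto simp: E_def E'_def)
  ultimately have prob_eq: "prob E = prob E'"
    by (simp add: measure_distr)
  have events: "E \<in> events" "E' \<in> events"
    using measurable_superlinear_sums[of 0 Y M] measurable_superlinear_sums[of 0 "\<lambda>n w. - Y n w" M]
    unfolding E_def E'_def superlinear_sums_tail[of _ 0] by simp_all
  let ?A = "\<lambda>n. sigma_sets (space M) {Y n -` B \<inter> space M | B. B \<in> sets borel}"
  have "prob E = 0 \<or> prob E = 1"
  proof (rule kolmogorov_0_1_law[of ?A])
    show "sigma_algebra (space M) (?A i)" for i
      by (rule sigma_algebra_sigma_sets) auto
    show "indep_sets ?A UNIV"
      using indep by (simp add: indep_vars_def)
    show "E \<in> tail_events ?A"
      unfolding tail_events_def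
    proof
      fix m
      let ?G = "\<Union>(?A ` {m..})"
      have Pow: "?G \<subseteq> Pow (space M)"
        using sigma_sets_into_sp[of "{Y n -` B \<inter> space M | B. B \<in> sets borel}" "space M" for n] by auto
      have "Y k \<in> borel_measurable (sigma (space M) ?G)" if "k > m" for k
      proof (rule measurableI)
        fix B :: "real set" assume "B \<in> sets borel"
        then have "Y k -` B \<inter> space M \<in> ?G"
          using that by (intro UN_I[of k] sigma_sets.Basic) auto
        then show "Y k -` B \<inter> space (sigma (space M) ?G) \<in> sets (sigma (space M) ?G)"
          using Pow by (simp only: space_measure_of sets_measure_of) (rule sigma_sets.Basic)
      qed simp
      from measurable_superlinear_sums[of m Y, OF this]
      show "E \<in> sigma_sets (space M) ?G"
        using Pow by (simp only: E_def superlinear_sums_tail[of _ m] space_measure_of sets_measure_of)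
    qed
  qed
  moreover have "AE w in M. \<forall>K::nat. \<exists>\<^sub>F n in sequentially. real K * real n \<le> \<bar>Y n w\<bar>"
    using large by (simp add: AE_all_countable)
  then have "AE w in M. w \<in> E \<union> E'"
  proof (rule AE_mp, intro AE_I2 impI)
    fix w assume "w \<in> space M" "\<forall>K::nat. \<exists>\<^sub>F n in sequentially. real K * real n \<le> \<bar>Y n w\<bar>"
    then show "w \<in> E \<union> E'"
      using superlinear_sums_or_uminus[of "\<lambda>n. Y n w"] by (auto simp: E_def E'_def)
  qed
  then have "prob (E \<union> E') = 1"
    using events by (simp add: prob_eq_1)
  \<comment> \<open>With equal probabilities this gives \<open>prob E \<ge> 1/2\<close>, which
    excludes the value 0.\<close>
  then have "1 \<le> prob E + prob E'"
    using measure_Un_le[OF events] by simp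
  ultimately have "prob E = 1"
    using prob_eq by auto
  then show ?thesis
    using events by (auto simp: prob_eq_1 E_def elim: eventually_mono)
qed

section \<open>Moments and averages\<close>

text \<open>For nonnegative terms no summation by parts is needed: beyond \<open>N\<close> each
  \<open>a k\<close> with \<open>k \<le> n\<close> is at most \<open>n * (a k / k)\<close>, so that
  part is \<open>n\<close> times a small tail of the series, and the head is a constant divided by
  \<open>n\<close>.\<close>

lemma kronecker_nonneg:
  fixes a :: "nat \<Rightarrow> real"
  assumes nonneg: "\<And>n. 0 \<le> a n" and summable: "summable (\<lambda>n. a n / real n)"
  shows "(\<lambda>n. (\<Sum>k=1..n. a k) / real n) \<longlonglongrightarrow> 0"
proof (rule order_tendstoI)
  fix e :: real assume "e < 0"
  then show "\<forall>\<^sub>F n in sequentially. e < (\<Sum>k=1..n. a k) / real n"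
    using nonneg by (intro always_eventually allI) (meson divide_nonneg_nonneg le_less_trans not_le of_nat_0_le_iff sum_nonneg)
next
  fix e :: real assume "0 < e"
  then obtain N where N: "\<And>m n. m \<ge> N \<Longrightarrow> norm (\<Sum>k=m..n. a k / real k) < e / 2"
    using summable_partial_sum_bound[OF summable, of "e / 2"] by auto
  define C where "C = (\<Sum>k=1..N. a k)"
  have "\<forall>\<^sub>F n in sequentially. C / real n < e / 2"
    using \<open>0 < e\<close> by (intro order_tendstoD(2)[OF lim_const_over_n]) simp
  then show "\<forall>\<^sub>F n in sequentially. (\<Sum>k=1..n. a k) / real n < e"
    using eventually_ge_at_top[of N] eventually_gt_at_top[of 0]
  proof eventually_elim
    case (elim n)
    have "{1..n} = {1..N} \<union> {Suc N..n}"
      using elim by auto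
    then have "(\<Sum>k=1..n. a k) = C + (\<Sum>k=Suc N..n. a k)"
      by (simp add: C_def sum.union_disjoint)
    also have "(\<Sum>k=Suc N..n. a k) \<le> (\<Sum>k=Suc N..n. a k / real k * real n)"
    proof (rule sum_mono)
      fix k assume k: "k \<in> {Suc N..n}"
      then have "a k / real k * real k \<le> a k / real k * real n"
        using nonneg[of k] by (intro mult_left_mono divide_nonneg_nonneg) simp_all
      moreover have "a k / real k * real k = a k"
        using k by simp
      ultimately show "a k \<le> a k / real k * real n" by linarith
    qed
    also have "\<dots> = (\<Sum>k=Suc N..n. a k / real k) * real n"
      by (simp add: sum_distrib_right)
    also have "(\<Sum>k=Suc N..n. a k / real k) < e / 2"
      using N[of "Suc N" n] by (simp add: abs_less_iff)
    finally have "(\<Sum>k=1..n. a k) < C + e / 2 * real n"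
      using elim by simp
    then have "(\<Sum>k=1..n. a k) / real n < C / real n + e / 2"
      using elim by (simp add: field_simps)
    also have "\<dots> < e / 2 + e / 2"
      using elim by (intro add_strict_right_mono)
    finally show ?case by simp
  qed
qed

text \<open>Exchanging sum and integral shows that the series has finite integral, hence is finite
  almost everywhere.\<close>

lemma AE_summable:
  fixes f :: "nat \<Rightarrow> 'a \<Rightarrow> real"
  assumes int: "\<And>n. integrable M (f n)" and nonneg: "\<And>n w. 0 \<le> f n w"
    and summable: "summable (\<lambda>n. \<integral>w. f n w \<partial>M)"
  shows "AE w in M. summable (\<lambda>n. f n w)"
proof -
  have [measurable]: "f n \<in> borel_measurable M" for n
    using int by simp
  have "(\<integral>\<^sup>+w. (\<Sum>n. ennreal (f n w)) \<partial>M) = (\<Sum>n. \<integral>\<^sup>+w. ennreal (f n w) \<partial>M)"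
    by (rule nn_integral_suminf) measurable
  also have "\<dots> = (\<Sum>n. ennreal (\<integral>w. f n w \<partial>M))"
    using int nonneg by (simp add: nn_integral_eq_integral)
  also have "\<dots> \<noteq> top"
    using summable nonneg by (intro ennreal_suminf_neq_top integral_nonneg) auto
  finally have "AE w in M. (\<Sum>n. ennreal (f n w)) \<noteq> \<infinity>"
    by (intro nn_integral_noteq_infinite) auto
  then show ?thesis
    by (rule eventually_mono) (auto intro: summable_suminf_not_top nonneg)
qed

text \<open>Dyadic decomposition: the tail bound at 2^j turns the moment into a series dominated by
  a geometric one with ratio 2^(\<gamma> - \<alpha>) < 1.\<close>

lemma (in prob_space) integrable_powr_if_tail_bound:
  fixes X :: "'a \<Rightarrow> real"
  assumes rv [measurable]: "random_variable borel X" and nonneg: "\<And>w. 0 \<le> X w"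
    and tail: "\<forall>\<^sub>F r in at_top. prob {w \<in> space M. X w > r} \<le> C * r powr (- \<alpha>)"
    and \<gamma>: "0 \<le> \<gamma>" "\<gamma> < \<alpha>"
  shows "integrable M (\<lambda>w. X w powr \<gamma>)"
proof -
  define g where "g j = (2 ^ Suc j) powr \<gamma> * prob {w \<in> space M. X w > 2 ^ j}" for j :: nat
  have term_le: "f j \<le> (\<Sum>j. f j)" for f :: "nat \<Rightarrow> ennreal" and j
    using sum_le_suminf[of f "{j}"] by simp
  have dyadic: "ennreal (X w powr \<gamma>) \<le>
      1 + (\<Sum>j. ennreal ((2 ^ Suc j) powr \<gamma>) * indicator {w \<in> space M. X w > 2 ^ j} w)"
    if w: "w \<in> space M" for w
  proof (cases "X w \<le> 1")
    case True
    then have "ennreal (X w powr \<gamma>) \<le> 1"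
      using nonneg \<gamma> by (simp add: powr_le1)
    then show ?thesis
      by (rule order_trans) simp
  next
    case False
    \<comment> \<open>As \<open>X w > 1\<close>, this \<open>m\<close> is positive; with
      \<open>m = Suc j\<close> the value lies in (2^j, 2^(j+1)], and the single term
      \<open>j\<close> of the series already dominates.\<close>
    define m where "m = (LEAST m. X w \<le> 2 ^ m)"
    obtain m' where "X w < 2 ^ m'"
      using real_arch_pow[of 2 "X w"] by auto
    then have m: "X w \<le> 2 ^ m"
      unfolding m_def using LeastI[of "\<lambda>m. X w \<le> 2 ^ m" m'] by simp
    with False obtain j where j: "m = Suc j"
      by (cases m) auto
    then have "\<not> X w \<le> 2 ^ j"
      unfolding m_def using not_less_Least[of j "\<lambda>m. X w \<le> 2 ^ m"] by auto
    then have "indicator {w \<in> space M. X w > 2 ^ j} w = (1 :: ennreal)"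
      using w unfolding indicator_def by simp
    moreover have "X w powr \<gamma> \<le> (2 ^ Suc j) powr \<gamma>"
      using m nonneg \<gamma> unfolding j by (intro powr_mono2)
    ultimately have "ennreal (X w powr \<gamma>) \<le>
        ennreal ((2 ^ Suc j) powr \<gamma>) * indicator {w \<in> space M. X w > 2 ^ j} w"
      by (simp only: mult_1_right ennreal_leI)
    also have "\<dots> \<le> (\<Sum>j. ennreal ((2 ^ Suc j) powr \<gamma>) * indicator {w \<in> space M. X w > 2 ^ j} w)"
      by (rule term_le)
    finally show ?thesis
      by (rule add_increasing[OF zero_le])
  qed
  have pow: "(2 ^ j) powr s = (2 powr s :: real) ^ j" for s j
  proof -
    have "((2::real) ^ j) powr s = (2 powr real j) powr s"
      by (simp only: powr_realpow[of 2] zero_less_numeral)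
    also have "\<dots> = (2 powr s) powr real j"
      by (simp only: powr_powr mult.commute)
    also have "\<dots> = (2 powr s) ^ j"
      by (rule powr_realpow) simp
    finally show ?thesis .
  qed
  have powr_diff_eq: "(2::real) powr (\<gamma> - \<alpha>) = 2 powr \<gamma> * 2 powr (- \<alpha>)"
    by (simp only: powr_add[symmetric] diff_conv_add_uminus)
  have "summable g"
  proof (rule summable_comparison_test_ev)
    have "\<forall>\<^sub>F j in sequentially. prob {w \<in> space M. X w > 2 ^ j} \<le> C * (2 ^ j) powr (- \<alpha>)"
    proof (rule eventually_compose_filterlim[OF tail])
      show "filterlim (\<lambda>j. 2 ^ j :: real) at_top sequentially"
        by (rule filterlim_at_top_mono[OF filterlim_real_sequentially])
          (simp add: of_nat_less_two_power less_imp_le)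
    qed
    then show "\<forall>\<^sub>F j in sequentially. norm (g j) \<le> 2 powr \<gamma> * C * (2 powr (\<gamma> - \<alpha>)) ^ j"
    proof eventually_elim
      case (elim j)
      have "norm (g j) \<le> (2 ^ Suc j) powr \<gamma> * (C * (2 ^ j) powr (- \<alpha>))"
        unfolding g_def using elim by (auto simp: abs_mult intro!: mult_left_mono)
      also have "\<dots> = 2 powr \<gamma> * C * (2 powr (\<gamma> - \<alpha>)) ^ j"
        unfolding power_Suc powr_mult pow powr_diff_eq power_mult_distrib by (simp only: mult_ac)
      finally show ?case .
    qed
    show "summable (\<lambda>j. 2 powr \<gamma> * C * (2 powr (\<gamma> - \<alpha>)) ^ j)"
      using \<gamma> powr_less_mono[of "\<gamma> - \<alpha>" 0 "2 :: real"]
      by (intro summable_mult summable_geometric) simp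
  qed
  have suminf_finite: "(\<Sum>j. ennreal (g j)) \<noteq> top"
    by (rule ennreal_suminf_neq_top[OF \<open>summable g\<close>]) (simp add: g_def)
  have "(\<integral>\<^sup>+w. ennreal (X w powr \<gamma>) \<partial>M) \<le>
      (\<integral>\<^sup>+w. 1 + (\<Sum>j. ennreal ((2 ^ Suc j) powr \<gamma>) * indicator {w \<in> space M. X w > 2 ^ j} w) \<partial>M)"
    using dyadic by (rule nn_integral_mono)
  also have "\<dots> = 1 + (\<Sum>j. ennreal (g j))"
    by (subst nn_integral_add)
      (simp_all add: nn_integral_suminf emeasure_space_1 nn_integral_cmult_indicator emeasure_eq_measure
        g_def ennreal_mult' prob_space)
  also have "\<dots> < \<infinity>"
    using suminf_finite by (simp add: less_top[symmetric])
  finally show ?thesis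
    by (intro integrableI_bounded) auto
qed

section \<open>The mixed environment with symmetric heavy-tailed log-odds\<close>

locale symmetric_heavy_environment = mixed_environment +
  fixes \<alpha> \<beta> c :: real
  assumes symmetric: "\<And>x. x \<ge> 0 \<Longrightarrow>
      prob {w \<in> space M. log_odds \<xi> 0 w \<le> -x} = prob {w \<in> space M. log_odds \<xi> 0 w \<ge> x}"
    and \<alpha>: "\<alpha> \<in> {0<..<1}" and c: "c > 0"
    and tail: "(\<lambda>r. prob {w \<in> space M. log_odds \<xi> 0 w > r}) \<sim>[at_top] (\<lambda>r. c * r powr (-\<alpha>))"
    and \<beta>: "\<beta> \<in> {0<..<1}"
    and phi_eq: "\<And>n. n \<ge> 1 \<Longrightarrow> \<phi> n = 1 - real n powr (-\<beta>)"
begin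

text \<open>The contribution of a random site to the increment of the potential; a site with
  \<open>chi n w = 1\<close> contributes \<open>drift\<close> instead.\<close>

definition jump :: "nat \<Rightarrow> 'a \<Rightarrow> real" where
  "jump n w = (1 - chi n w) * log_odds \<xi> n w"

lemma chi_measurable [measurable]: "chi n \<in> borel_measurable M"
  using chi_indep by (auto simp: indep_vars_def)

lemma xi_measurable [measurable]: "\<xi> n \<in> borel_measurable M"
  using xi_indep by (auto simp: indep_vars_def)

lemma log_odds_measurable [measurable]: "log_odds \<xi> n \<in> borel_measurable M"
  unfolding log_odds_def[abs_def] by measurable

lemma jump_measurable [measurable]: "jump n \<in> borel_measurable M"
  unfolding jump_def[abs_def] by measurable

lemma distr_log_odds: "distr M borel (log_odds \<xi> n) = distr M borel (log_odds \<xi> 0)"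
proof -
  have "distr M borel (log_odds \<xi> n) = distr (distr M borel (\<xi> n)) borel (\<lambda>x. ln (x / (1 - x)))" for n
    by (subst distr_distr) (simp_all add: comp_def log_odds_def[abs_def])
  then show ?thesis
    by (metis xi_ident)
qed

lemma prob_log_odds:
  assumes "B \<in> sets borel"
  shows "prob {w \<in> space M. log_odds \<xi> n w \<in> B} = prob {w \<in> space M. log_odds \<xi> 0 w \<in> B}"
proof -
  have "prob {w \<in> space M. log_odds \<xi> n w \<in> B} = measure (distr M borel (log_odds \<xi> n)) B" for n
    using assms by (simp add: measure_distr vimage_def Int_def conj_commute)
  then show ?thesis
    using distr_log_odds by metis
qed

lemma chi_log_odds_indep: "indep_var borel (chi n) borel (log_odds \<xi> n)"
proof -
  have "indep_var borel ((\<lambda>x. x n) \<circ> (\<lambda>w n. chi n w)) borel ((\<lambda>x. ln (x n / (1 - x n))) \<circ> (\<lambda>w n. \<xi> n w))"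
    by (rule indep_var_compose[OF chi_xi_indep]) measurable
  then show ?thesis
    by (simp add: comp_def log_odds_def[abs_def])
qed

lemma jump_indep: "indep_vars (\<lambda>_. borel) jump UNIV"
proof -
  have "indep_vars (\<lambda>n. borel \<Otimes>\<^sub>M borel) (\<lambda>n w. (chi n w, \<xi> n w)) UNIV"
    by (rule indep_vars_Pair[OF chi_indep xi_indep chi_xi_indep])
  then have "indep_vars (\<lambda>_. borel)
      (\<lambda>n w. (\<lambda>(x, y). (1 - x) * ln (y / (1 - y))) (chi n w, \<xi> n w)) UNIV"
    by (rule indep_vars_compose2) measurable
  then show ?thesis
    by (simp add: jump_def[abs_def] log_odds_def)
qed

lemma prob_chi_0: "n \<ge> 1 \<Longrightarrow> prob {w \<in> space M. chi n w = 0} = real n powr (-\<beta>)"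
proof -
  assume "n \<ge> 1"
  have "{w \<in> space M. chi n w = 0} = space M - {w \<in> space M. chi n w = 1}"
    using chi_values by fastforce
  then show ?thesis
    using \<open>n \<ge> 1\<close> by (simp add: prob_compl chi_prob phi_eq)
qed

lemma expectation_one_minus_chi: "n \<ge> 1 \<Longrightarrow> expectation (\<lambda>w. 1 - chi n w) = real n powr (-\<beta>)"
proof -
  assume n: "n \<ge> 1"
  have "expectation (\<lambda>w. 1 - chi n w) = expectation (indicator {w \<in> space M. chi n w = 0})"
    using chi_values by (intro Bochner_Integration.integral_cong) (fastforce simp: indicator_def)+
  then show ?thesis
    using prob_chi_0[OF n] by simp
qed

lemma integrable_one_minus_chi: "integrable M (\<lambda>w. 1 - chi n w)"
proof (rule integrable_const_bound[of _ 1])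
  show "AE w in M. norm (1 - chi n w) \<le> 1"
  proof (rule AE_I2)
    fix w assume "w \<in> space M"
    then show "norm (1 - chi n w) \<le> 1"
      using chi_values[of w n] by auto
  qed
qed measurable

text \<open>The symmetry hypothesis gives equality of the two distribution functions on the
  nonpositive half-line; positive arguments are reached by taking complements.\<close>

lemma distr_uminus_log_odds: "distr M borel (\<lambda>w. - log_odds \<xi> n w) = distr M borel (log_odds \<xi> n)"
proof -
  let ?Z = "log_odds \<xi> n"
  let ?D = "distr M borel ?Z" and ?D' = "distr M borel (\<lambda>w. - ?Z w)"
  interpret D: real_distribution ?D by (rule real_distribution_distr) measurable
  interpret D': real_distribution ?D' by (rule real_distribution_distr) measurable
  have D: "measure ?D B = prob {w \<in> space M. ?Z w \<in> B}" if "B \<in> sets borel" for B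
    using that by (simp add: measure_distr vimage_def Int_def conj_commute)
  have D': "measure ?D' B = prob {w \<in> space M. - ?Z w \<in> B}" if "B \<in> sets borel" for B
    using that by (simp add: measure_distr vimage_def Int_def conj_commute)
  have cdf_nonpos: "cdf ?D x = cdf ?D' x" if "x \<le> 0" for x
  proof -
    have "prob {w \<in> space M. ?Z w \<le> x} = prob {w \<in> space M. ?Z w \<ge> -x}"
      using symmetric[of "-x"] that prob_log_odds[of "{..x}" n] prob_log_odds[of "{-x..}" n] by simp
    then show ?thesis
      by (simp add: cdf_def D D' minus_le_iff)
  qed
  \<comment> \<open>Complements turn weak inequalities into strict ones, so left limits of the
    distribution functions are needed as well.\<close>
  have left: "measure ?D {..<x} = measure ?D' {..<x}" if "x \<le> 0" for x
  proof (rule tendsto_unique)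
    show "(cdf ?D \<longlongrightarrow> measure ?D {..<x}) (at_left x)"
      by (rule D.cdf_at_left)
    have "\<forall>\<^sub>F y in at_left x. cdf ?D' y = cdf ?D y"
      using that cdf_nonpos by (auto simp: eventually_at_filter)
    then show "(cdf ?D \<longlongrightarrow> measure ?D' {..<x}) (at_left x)"
      using D'.cdf_at_left[of x] by (simp cong: tendsto_cong)
  qed simp
  have "cdf ?D x = cdf ?D' x" if "x > 0" for x
  proof -
    have "cdf ?D x = 1 - prob {w \<in> space M. - ?Z w < - x}"
      by (simp add: cdf_def D prob_neg[symmetric] not_less)
    also have "\<dots> = 1 - measure ?D' {..<-x}"
      by (simp add: D')
    also have "\<dots> = 1 - measure ?D {..<-x}"
      using left[of "-x"] that by simp
    also have "\<dots> = cdf ?D' x"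
      by (simp add: cdf_def D D' prob_neg[symmetric] not_less minus_le_iff)
    finally show ?thesis .
  qed
  with cdf_nonpos have "cdf ?D = cdf ?D'"
    by (intro ext) (meson not_le)
  then show ?thesis
    using cdf_unique[of ?D ?D'] D.real_distribution_axioms D'.real_distribution_axioms by simp
qed

text \<open>By independence, negating the log-odds alone leaves the joint law with
  \<open>chi n\<close> unchanged, and negating the jump amounts to just that.\<close>

lemma distr_uminus_jump: "distr M borel (\<lambda>w. - jump n w) = distr M borel (jump n)"
proof -
  let ?f = "\<lambda>(x, z). (1 - x) * z :: real"
  have "indep_var borel ((\<lambda>x. x) \<circ> chi n) borel (uminus \<circ> log_odds \<xi> n)"
    by (rule indep_var_compose[OF chi_log_odds_indep]) measurable
  then have "distr M (borel \<Otimes>\<^sub>M borel) (\<lambda>w. (chi n w, - log_odds \<xi> n w)) =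
      distr M borel (chi n) \<Otimes>\<^sub>M distr M borel (\<lambda>w. - log_odds \<xi> n w)"
    by (simp add: indep_var_distribution_eq comp_def)
  also have "\<dots> = distr M (borel \<Otimes>\<^sub>M borel) (\<lambda>w. (chi n w, log_odds \<xi> n w))"
    using chi_log_odds_indep[of n] by (simp add: indep_var_distribution_eq distr_uminus_log_odds)
  finally have "distr (distr M (borel \<Otimes>\<^sub>M borel) (\<lambda>w. (chi n w, - log_odds \<xi> n w))) borel ?f =
      distr (distr M (borel \<Otimes>\<^sub>M borel) (\<lambda>w. (chi n w, log_odds \<xi> n w))) borel ?f"
    by (rule arg_cong)
  then show ?thesis
    by (simp add: distr_distr comp_def jump_def[abs_def])
qed

section \<open>Tails of the log-odds and large jumps\<close>

lemma eventually_tail_bounds: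
  "\<forall>\<^sub>F r in at_top. c / 2 * r powr (-\<alpha>) \<le> prob {w \<in> space M. log_odds \<xi> 0 w > r} \<and>
     prob {w \<in> space M. log_odds \<xi> 0 w > r} \<le> 2 * c * r powr (-\<alpha>)"
proof -
  let ?T = "\<lambda>r. prob {w \<in> space M. log_odds \<xi> 0 w > r}"
  \<comment> \<open>Asymptotic equivalence reads 0/0 as 1. For \<open>r > 0\<close> the denominator
    is positive, so this is an ordinary ratio, eventually between 1/2 and 2.\<close>
  have "((\<lambda>r. if ?T r = 0 \<and> c * r powr (-\<alpha>) = 0 then 1 else ?T r / (c * r powr (-\<alpha>))) \<longlongrightarrow> 1) at_top"
    using tail by (simp add: asymp_equiv_def)
  then have "\<forall>\<^sub>F r in at_top. (if ?T r = 0 \<and> c * r powr (-\<alpha>) = 0 then 1 else ?T r / (c * r powr (-\<alpha>))) \<in> {1/2<..<2}"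
    by (rule topological_tendstoD) auto
  then show ?thesis
    using eventually_gt_at_top[of 0]
  proof eventually_elim
    case (elim r)
    have pos: "c * r powr (-\<alpha>) > 0"
      using elim c by simp
    then have "\<not> (?T r = 0 \<and> c * r powr (-\<alpha>) = 0)"
      by (metis less_irrefl)
    from elim(1)[unfolded if_not_P[OF this]] pos have "1 / 2 * (c * r powr (-\<alpha>)) < ?T r" "?T r < 2 * (c * r powr (-\<alpha>))"
      by (simp_all only: greaterThanLessThan_iff pos_less_divide_eq pos_divide_less_eq)
    then show ?case by simp
  qed
qed

lemma prob_jump_ge:
  assumes "n \<ge> 1" "r \<ge> 0"
  shows "real n powr (-\<beta>) * prob {w \<in> space M. log_odds \<xi> 0 w > r} \<le>
    prob {w \<in> space M. \<bar>jump n w\<bar> \<ge> r}"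
proof -
  have "prob {w \<in> space M. log_odds \<xi> 0 w > r} = prob {w \<in> space M. log_odds \<xi> n w > r}"
    using prob_log_odds[of "{r<..}" n] by simp
  then have "real n powr (-\<beta>) * prob {w \<in> space M. log_odds \<xi> 0 w > r} =
      prob (chi n -` {0} \<inter> space M) * prob (log_odds \<xi> n -` {r<..} \<inter> space M)"
    using prob_chi_0[OF assms(1)] by (simp add: vimage_def Int_def conj_commute)
  also have "\<dots> = prob ((\<lambda>w. (chi n w, log_odds \<xi> n w)) -` ({0} \<times> {r<..}) \<inter> space M)"
    using indep_varD[OF chi_log_odds_indep, of "{0}" "{r<..}" n] by simp
  also have "\<dots> \<le> prob {w \<in> space M. \<bar>jump n w\<bar> \<ge> r}"
    by (intro finite_measure_mono) (auto simp: jump_def)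
  finally show ?thesis .
qed

text \<open>A jump of size \<open>L * n\<close> at site \<open>n\<close> has probability at least a
  constant times n^(-(\<alpha> + \<beta>)), which is not summable when \<alpha> + \<beta> <
  1.\<close>

lemma AE_large_jumps:
  assumes "\<beta> < 1 - \<alpha>"
  shows "AE w in M. \<exists>\<^sub>F n in sequentially. real K * real n \<le> \<bar>jump n w\<bar>"
proof -
  \<comment> \<open>\<open>Suc K\<close> rather than \<open>K\<close>: the level
    \<open>L * n\<close> must tend to infinity even for \<open>K = 0\<close>.\<close>
  define L where "L = real (Suc K)"
  let ?p = "\<lambda>n. prob (jump n -` {x. \<bar>x\<bar> \<ge> L * real n} \<inter> space M)"
  have "\<not> summable ?p"
  proof
    assume "summable ?p"
    have "\<forall>\<^sub>F n in sequentially. c / 2 * (L * real n) powr (-\<alpha>) \<le>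
        prob {w \<in> space M. log_odds \<xi> 0 w > L * real n}"
    proof (rule eventually_compose_filterlim[where f="\<lambda>n. L * real n"
          and P="\<lambda>r. c / 2 * r powr (-\<alpha>) \<le> prob {w \<in> space M. log_odds \<xi> 0 w > r}"])
      show "\<forall>\<^sub>F r in at_top. c / 2 * r powr (-\<alpha>) \<le> prob {w \<in> space M. log_odds \<xi> 0 w > r}"
        using eventually_tail_bounds by (rule eventually_mono) simp
      show "filterlim (\<lambda>n. L * real n) at_top sequentially"
        by (rule filterlim_tendsto_pos_mult_at_top[OF tendsto_const _ filterlim_real_sequentially])
          (simp add: L_def)
    qed
    then have "\<forall>\<^sub>F n in sequentially. norm (c / 2 * L powr (-\<alpha>) * real n powr (-(\<alpha> + \<beta>))) \<le> ?p n"
      using eventually_ge_at_top[of 1]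
    proof eventually_elim
      case (elim n)
      have add: "real n powr (- \<alpha> - \<beta>) = real n powr (-\<alpha>) * real n powr (-\<beta>)"
        by (simp add: powr_add[symmetric])
      have "norm (c / 2 * L powr (-\<alpha>) * real n powr (-(\<alpha> + \<beta>))) =
          real n powr (-\<beta>) * (c / 2 * (L * real n) powr (-\<alpha>))"
        using c by (simp add: abs_mult powr_mult add)
      also have "\<dots> \<le> real n powr (-\<beta>) * prob {w \<in> space M. log_odds \<xi> 0 w > L * real n}"
        using elim by (intro mult_left_mono) auto
      also have "\<dots> \<le> ?p n"
        using prob_jump_ge[of n "L * real n"] elim
        by (simp add: L_def vimage_def Int_def conj_commute)
      finally show ?case .
    qed
    from summable_comparison_test_ev[OF this \<open>summable ?p\<close>]
    have "summable (\<lambda>n. real n powr (-(\<alpha> + \<beta>)))"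
      using c by (simp add: L_def)
    with assms show False
      by (simp add: summable_real_powr_iff)
  qed
  then have "AE w in M. \<exists>\<^sub>F n in sequentially. jump n w \<in> {x. \<bar>x\<bar> \<ge> L * real n}"
    by (intro borel_cantelli_indep_vars[OF jump_indep]) auto
  then show ?thesis
    by (rule eventually_mono) (auto simp: L_def algebra_simps elim!: frequently_elim1)
qed

section \<open>The potential of the walk and the case of small \<beta>\<close>

definition drift :: real where
  "drift = ln ((1 - \<delta>) / (1 + \<delta>))"

lemma ln_site_prob_odds:
  assumes "w \<in> space M"
  shows "ln (site_prob \<delta> chi \<xi> w n / (1 - site_prob \<delta> chi \<xi> w n)) = chi n w * drift + jump n w"
proof -
  consider "chi n w = 0" | "chi n w = 1"
    using chi_values[OF assms, of n] by blast
  then show ?thesis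
  proof cases
    case 1
    then show ?thesis
      by (simp add: site_prob_def jump_def log_odds_def)
  next
    case 2
    have "1 - (1 - \<delta>) / 2 = (1 + \<delta>) / 2"
      by (simp add: field_simps)
    then have "(1 - \<delta>) / 2 / (1 - (1 - \<delta>) / 2) = (1 - \<delta>) / (1 + \<delta>)"
      by (simp only: divide_divide_eq_left divide_divide_eq_right)
    moreover have "site_prob \<delta> chi \<xi> w n = (1 - \<delta>) / 2"
      using 2 by (simp add: site_prob_def)
    ultimately show ?thesis
      using 2 by (simp only: drift_def) (simp add: jump_def)
  qed
qed

lemma walk_site_prob: "w \<in> space M \<Longrightarrow> walk (site_prob \<delta> chi \<xi> w)"
  by (intro walk.intro site_prob_in_unit_interval)

lemma AE_recurrent_small_\<beta>:
  assumes "\<beta> < 1 - \<alpha>"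
  shows "AE w in M. recurrent_chain (walk_kernel (site_prob \<delta> chi \<xi> w))"
proof -
  have "AE w in M. superlinear_sums (\<lambda>n. jump n w)"
    using jump_indep distr_uminus_jump AE_large_jumps[OF assms] by (rule AE_superlinear_sums)
  then show ?thesis
  proof (rule AE_mp, intro AE_I2 impI)
    fix w assume w: "w \<in> space M" and sums: "superlinear_sums (\<lambda>n. jump n w)"
    interpret walk "site_prob \<delta> chi \<xi> w"
      using w by (rule walk_site_prob)
    \<comment> \<open>The drift can lower the potential by at most \<open>K * n\<close>, and the
      jumps exceed this infinitely often.\<close>
    obtain K :: nat where K: "\<bar>drift\<bar> \<le> real K"
      using real_arch_simple by blast
    have "\<exists>\<^sub>F n in sequentially. real K * real n < (\<Sum>k=1..n. jump k w)"
      using sums by (simp add: superlinear_sums_def)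
    then show "recurrent_chain (walk_kernel (site_prob \<delta> chi \<xi> w))"
    proof (rule recurrent_if_frequently_nonneg[OF frequently_elim1])
      fix n assume *: "real K * real n < (\<Sum>k=1..n. jump k w)"
      have "(\<Sum>k=1..n. - (chi k w * drift)) \<le> (\<Sum>k=1..n. real K)"
      proof (rule sum_mono)
        fix k show "- (chi k w * drift) \<le> real K"
          using chi_values[OF w, of k] K by auto
      qed
      then have "0 \<le> (\<Sum>k=1..n. chi k w * drift + jump k w)"
        using * by (simp add: sum.distrib sum_negf mult.commute)
      then show "0 \<le> (\<Sum>k=1..n. ln (site_prob \<delta> chi \<xi> w k / (1 - site_prob \<delta> chi \<xi> w k)))"
        using w by (simp add: ln_site_prob_odds)
    qed
  qed
qed

section \<open>Linear growth of the potential for large \<beta>\<close>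

lemma integrable_log_odds_powr:
  assumes "0 \<le> \<gamma>" "\<gamma> < \<alpha>" "b \<ge> 0"
  shows "integrable M (\<lambda>w. (\<bar>log_odds \<xi> n w\<bar> + b) powr \<gamma>)"
proof (rule integrable_powr_if_tail_bound[OF _ _ _ assms(1,2)])
  \<comment> \<open>For \<open>r \<ge> 2 * b\<close> the event forces the log-odds beyond r/2 in
    absolute value. Symmetry doubles one tail, the tail bound costs \<open>2 * c\<close>, and
    lowering r/2 to r/4 makes the inequality strict.\<close>
  define C where "C = 4 * c * 4 powr \<alpha>"
  have "\<forall>\<^sub>F r in at_top. prob {w \<in> space M. log_odds \<xi> 0 w > r / 4} \<le> 2 * c * (r / 4) powr (-\<alpha>)"
  proof (rule eventually_compose_filterlim[where f="\<lambda>r. r / 4"])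
    show "\<forall>\<^sub>F r in at_top. prob {w \<in> space M. log_odds \<xi> 0 w > r} \<le> 2 * c * r powr (-\<alpha>)"
      using eventually_tail_bounds by (rule eventually_mono) simp
    show "filterlim (\<lambda>r::real. r / 4) at_top at_top"
      using filterlim_tendsto_pos_mult_at_top[OF tendsto_const[of "1/4::real"] _ filterlim_ident[of at_top]]
      by simp
  qed
  then show "\<forall>\<^sub>F r in at_top. prob {w \<in> space M. \<bar>log_odds \<xi> n w\<bar> + b > r} \<le> C * r powr (-\<alpha>)"
    using eventually_ge_at_top[of "2 * b"] eventually_gt_at_top[of 0]
  proof eventually_elim
    case (elim r)
    let ?Z = "log_odds \<xi> 0"
    have "prob {w \<in> space M. \<bar>log_odds \<xi> n w\<bar> + b > r} = prob {w \<in> space M. \<bar>?Z w\<bar> + b > r}"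
      using prob_log_odds[of "{x. \<bar>x\<bar> + b > r}" n] by simp
    also have "\<dots> \<le> prob ({w \<in> space M. ?Z w \<ge> r / 2} \<union> {w \<in> space M. ?Z w \<le> - (r / 2)})"
      using elim by (intro finite_measure_mono) auto
    also have "\<dots> \<le> prob {w \<in> space M. ?Z w \<ge> r / 2} + prob {w \<in> space M. ?Z w \<le> - (r / 2)}"
      by (intro measure_Un_le) measurable
    also have "\<dots> = 2 * prob {w \<in> space M. ?Z w \<ge> r / 2}"
      using symmetric[of "r / 2"] elim by simp
    also have "prob {w \<in> space M. ?Z w \<ge> r / 2} \<le> prob {w \<in> space M. ?Z w > r / 4}"
      using elim by (intro finite_measure_mono) auto
    also have "\<dots> \<le> 2 * c * (r / 4) powr (-\<alpha>)"
      by (rule elim)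
    also have "2 * (2 * c * (r / 4) powr (-\<alpha>)) = C * r powr (-\<alpha>)"
      using elim by (simp add: C_def powr_divide powr_minus field_simps)
    finally show ?case by simp
  qed
qed (use assms(3) in auto)

text \<open>The offset \<open>b\<close> will be \<open>\<bar>drift\<bar>\<close>: a random site adds
  its log-odds and also removes one drift increment.\<close>

lemma AE_average_perturbation:
  assumes "\<beta> > 1 - \<alpha>" "b \<ge> 0"
  shows "AE w in M. (\<lambda>n. (\<Sum>k=1..n. (1 - chi k w) * (\<bar>log_odds \<xi> k w\<bar> + b)) / real n) \<longlonglongrightarrow> 0"
proof -
  \<comment> \<open>Being below \<alpha> makes the \<gamma>-th moment finite; being above 1 -
    \<beta> makes n^(-(\<beta> + \<gamma>)) summable.\<close>
  obtain \<gamma> where "max (1 - \<beta>) 0 < \<gamma>" "\<gamma> < \<alpha>"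
    using dense[of "max (1 - \<beta>) 0" \<alpha>] assms(1) \<alpha> by auto
  then have \<gamma>: "0 < \<gamma>" "\<gamma> < \<alpha>" "\<gamma> < 1" "\<beta> + \<gamma> > 1"
    using \<alpha> by auto
  have le_powr: "x \<le> x powr \<gamma>" if "0 \<le> x" "x powr \<gamma> < 1" for x :: real
  proof (cases "x = 0")
    case False
    then have "x < 1"
      using that \<gamma> ge_one_powr_ge_zero[of x \<gamma>] by linarith
    then have "x powr 1 \<le> x powr \<gamma>"
      using that \<gamma> by (intro powr_mono') auto
    then show ?thesis
      using that by simp
  qed simp
  define U where "U n w = (\<bar>log_odds \<xi> n w\<bar> + b) powr \<gamma>" for n w
  define C where "C = expectation (U 0)"
  \<comment> \<open>The absolute value gives nonnegativity at every point, even outside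
    \<open>space M\<close>, as \<open>AE_summable\<close> requires.\<close>
  define f where "f n w = \<bar>1 - chi n w\<bar> * U n w / real n powr \<gamma>" for n w
  have U_int: "integrable M (U n)" for n
    unfolding U_def using \<gamma> assms(2) by (intro integrable_log_odds_powr) auto
  have "expectation (U n) = (\<integral>x. (\<bar>x\<bar> + b) powr \<gamma> \<partial>distr M borel (log_odds \<xi> n))" for n
    unfolding U_def by (subst integral_distr) auto
  then have U_exp: "expectation (U n) = C" for n
    unfolding C_def using distr_log_odds by metis
  have indep: "indep_var borel (\<lambda>w. 1 - chi n w) borel (U n)" for n
  proof -
    have "indep_var borel ((\<lambda>x. 1 - x) \<circ> chi n) borel ((\<lambda>x. (\<bar>x\<bar> + b) powr \<gamma>) \<circ> log_odds \<xi> n)"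
      by (rule indep_var_compose[OF chi_log_odds_indep]) measurable
    then show ?thesis by (simp add: comp_def U_def[abs_def])
  qed
  have f_eq: "f n w = (1 - chi n w) * U n w / real n powr \<gamma>" if "w \<in> space M" for n w
    using chi_values[OF that, of n] by (auto simp: f_def)
  have f_int: "integrable M (f n)" for n
    using indep_var_integrable[OF indep integrable_one_minus_chi U_int, of n]
    by (subst Bochner_Integration.integrable_cong[OF refl f_eq]) auto
  have f_exp: "expectation (f n) = C * real n powr (- (\<beta> + \<gamma>))" if "n \<ge> 1" for n
  proof -
    have "expectation (f n) = expectation (\<lambda>w. (1 - chi n w) * U n w / real n powr \<gamma>)"
      by (intro Bochner_Integration.integral_cong refl f_eq)
    also have "\<dots> = real n powr (-\<beta>) * C / real n powr \<gamma>"
      using that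
      by (simp add: indep_var_lebesgue_integral[OF indep integrable_one_minus_chi U_int]
          expectation_one_minus_chi U_exp)
    also have "\<dots> = C * (real n powr (-\<beta>) * real n powr (-\<gamma>))"
      by (simp add: powr_minus[of _ \<gamma>] divide_inverse)
    also have "real n powr (-\<beta>) * real n powr (-\<gamma>) = real n powr (- (\<beta> + \<gamma>))"
      by (simp add: powr_add[symmetric])
    finally show ?thesis .
  qed
  have "summable (\<lambda>n. C * real n powr (- (\<beta> + \<gamma>)))"
    using \<gamma> by (intro summable_mult) (simp add: summable_real_powr_iff)
  moreover have "\<forall>\<^sub>F n in sequentially. expectation (f n) = C * real n powr (- (\<beta> + \<gamma>))"
    using eventually_ge_at_top[of 1] by (rule eventually_mono) (rule f_exp)
  ultimately have "summable (\<lambda>n. expectation (f n))"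
    by (subst summable_cong)
  moreover have "0 \<le> f n w" for n w
    by (simp add: f_def U_def)
  ultimately have "AE w in M. summable (\<lambda>n. f n w)"
    by (intro AE_summable[OF f_int])
  then show ?thesis
  proof (rule AE_mp, intro AE_I2 impI)
    fix w assume w: "w \<in> space M" and summable: "summable (\<lambda>n. f n w)"
    let ?W = "\<lambda>n. (1 - chi n w) * (\<bar>log_odds \<xi> n w\<bar> + b)"
    have chi: "chi n w = 0 \<or> chi n w = 1" for n
      using chi_values[OF w, of n] by blast
    have W_nonneg: "0 \<le> ?W n" for n
      using chi[of n] assms(2) by (elim disjE) simp_all
    \<comment> \<open>\<open>1 - chi n w\<close> is 0 or 1 and thus equals its own \<gamma>-th
      power. As the terms tend to 0, \<open>le_powr\<close> eventually bounds the quotients by their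
      \<gamma>-th powers.\<close>
    have f_W: "f n w = (?W n / real n) powr \<gamma>" for n
      using chi[of n] by (elim disjE) (simp_all add: f_def U_def powr_divide)
    have "\<forall>\<^sub>F n in sequentially. f n w < 1"
      by (rule order_tendstoD(2)[OF summable_LIMSEQ_zero[OF summable]]) simp
    then have "\<forall>\<^sub>F n in sequentially. norm (?W n / real n) \<le> f n w"
    proof (rule eventually_mono)
      fix n assume "f n w < 1"
      then show "norm (?W n / real n) \<le> f n w"
        unfolding f_W real_norm_def abs_of_nonneg[OF divide_nonneg_nonneg[OF W_nonneg of_nat_0_le_iff]]
        by (rule le_powr[OF divide_nonneg_nonneg[OF W_nonneg of_nat_0_le_iff]])
    qed
    then have "summable (\<lambda>n. ?W n / real n)"
      using summable by (rule summable_comparison_test_ev)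
    then show "(\<lambda>n. (\<Sum>k=1..n. ?W k) / real n) \<longlonglongrightarrow> 0"
      using W_nonneg by (intro kronecker_nonneg)
  qed
qed

text \<open>The deviation from \<open>drift * n\<close> is the sum of
  \<open>log_odds - drift\<close> over the random sites, which
  \<open>AE_average_perturbation\<close> controls.\<close>

lemma AE_linear_potential:
  assumes "\<beta> > 1 - \<alpha>" "\<epsilon> > 0"
  shows "AE w in M. \<forall>\<^sub>F n in sequentially.
    \<bar>(\<Sum>k=1..n. ln (site_prob \<delta> chi \<xi> w k / (1 - site_prob \<delta> chi \<xi> w k))) - drift * real n\<bar> \<le> \<epsilon> * real n"
  using AE_average_perturbation[OF assms(1) abs_ge_zero[of drift]]
proof (rule AE_mp, intro AE_I2 impI)
  fix w assume w: "w \<in> space M"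
    and lim: "(\<lambda>n. (\<Sum>k=1..n. (1 - chi k w) * (\<bar>log_odds \<xi> k w\<bar> + \<bar>drift\<bar>)) / real n) \<longlonglongrightarrow> 0"
  let ?V = "\<lambda>n. \<Sum>k=1..n. ln (site_prob \<delta> chi \<xi> w k / (1 - site_prob \<delta> chi \<xi> w k))"
  show "\<forall>\<^sub>F n in sequentially. \<bar>?V n - drift * real n\<bar> \<le> \<epsilon> * real n"
    using order_tendstoD(2)[OF lim \<open>\<epsilon> > 0\<close>] eventually_gt_at_top[of 0]
  proof eventually_elim
    case (elim n)
    have "?V n - drift * real n = (\<Sum>k=1..n. chi k w * drift + jump k w) - (\<Sum>k=1..n. drift)"
      using w by (simp add: ln_site_prob_odds)
    also have "\<dots> = (\<Sum>k=1..n. (1 - chi k w) * (log_odds \<xi> k w - drift))"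
      unfolding sum_subtractf[symmetric] by (intro sum.cong) (auto simp: jump_def algebra_simps)
    also have "\<bar>\<dots>\<bar> \<le> (\<Sum>k=1..n. \<bar>(1 - chi k w) * (log_odds \<xi> k w - drift)\<bar>)"
      by (rule sum_abs)
    also have "\<dots> \<le> (\<Sum>k=1..n. (1 - chi k w) * (\<bar>log_odds \<xi> k w\<bar> + \<bar>drift\<bar>))"
    proof (rule sum_mono)
      fix k show "\<bar>(1 - chi k w) * (log_odds \<xi> k w - drift)\<bar> \<le> (1 - chi k w) * (\<bar>log_odds \<xi> k w\<bar> + \<bar>drift\<bar>)"
        using chi_values[OF w, of k] by auto
    qed
    also have "\<dots> \<le> \<epsilon> * real n"
      using elim by (simp add: pos_divide_less_eq)
    finally show ?case .
  qed
qed

lemma AE_recurrent_large_\<beta>: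
  assumes "\<beta> > 1 - \<alpha>" "\<delta> < 0"
  shows "AE w in M. recurrent_chain (walk_kernel (site_prob \<delta> chi \<xi> w))"
proof -
  have "drift > 0"
    using assms(2) delta by (simp add: drift_def)
  \<comment> \<open>The tolerance \<epsilon> is \<open>drift\<close> itself, which leaves exactly
    the lower bound 0 for the potential.\<close>
  from AE_linear_potential[OF assms(1) this] show ?thesis
  proof (rule AE_mp, intro AE_I2 impI)
    fix w assume w: "w \<in> space M" and V: "\<forall>\<^sub>F n in sequentially.
        \<bar>(\<Sum>k=1..n. ln (site_prob \<delta> chi \<xi> w k / (1 - site_prob \<delta> chi \<xi> w k))) - drift * real n\<bar> \<le> drift * real n"
    have "\<forall>\<^sub>F n in sequentially.
        0 \<le> (\<Sum>k=1..n. ln (site_prob \<delta> chi \<xi> w k / (1 - site_prob \<delta> chi \<xi> w k)))"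
      using V by (rule eventually_mono) linarith
    then show "recurrent_chain (walk_kernel (site_prob \<delta> chi \<xi> w))"
      by (intro walk.recurrent_if_frequently_nonneg[OF walk_site_prob[OF w]] eventually_frequently) simp
  qed
qed

lemma AE_transient_large_\<beta>:
  assumes "\<beta> > 1 - \<alpha>" "\<delta> > 0"
  shows "AE w in M. transient_chain (walk_kernel (site_prob \<delta> chi \<xi> w))"
proof -
  \<comment> \<open>Half of the negative slope is spent on the error, so the potential still
    decreases at rate \<epsilon>.\<close>
  define \<epsilon> where "\<epsilon> = - drift / 2"
  have "\<epsilon> > 0"
    using assms(2) delta by (simp add: drift_def \<epsilon>_def)
  have bound: "v \<le> - \<epsilon> * x" if "\<bar>v - drift * x\<bar> \<le> \<epsilon> * x" for v x
  proof -
    have "drift * x = - 2 * (\<epsilon> * x)" "- \<epsilon> * x = - (\<epsilon> * x)"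
      by (simp_all add: \<epsilon>_def)
    with that show ?thesis by linarith
  qed
  from AE_linear_potential[OF assms(1) \<open>\<epsilon> > 0\<close>] show ?thesis
  proof (rule AE_mp, intro AE_I2 impI)
    fix w assume w: "w \<in> space M" and V: "\<forall>\<^sub>F n in sequentially.
        \<bar>(\<Sum>k=1..n. ln (site_prob \<delta> chi \<xi> w k / (1 - site_prob \<delta> chi \<xi> w k))) - drift * real n\<bar> \<le> \<epsilon> * real n"
    from V have "\<forall>\<^sub>F n in sequentially.
        (\<Sum>k=1..n. ln (site_prob \<delta> chi \<xi> w k / (1 - site_prob \<delta> chi \<xi> w k))) \<le> - \<epsilon> * real n"
      by (rule eventually_mono) (rule bound)
    then show "transient_chain (walk_kernel (site_prob \<delta> chi \<xi> w))"
      by (rule walk.transient_if_linear_drift[OF walk_site_prob[OF w] \<open>\<epsilon> > 0\<close>])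
  qed
qed

end

theorem theorem2p6:
  fixes M :: "'a measure"
    and \<delta> \<alpha> \<beta> c :: real
    and \<phi> :: "nat \<Rightarrow> real"
    and chi \<xi> :: "nat \<Rightarrow> 'a \<Rightarrow> real"
  assumes "mixed_environment M \<delta> \<phi> chi \<xi>"
    and "\<And>x. x \<ge> 0 \<Longrightarrow>
          measure M {w \<in> space M. log_odds \<xi> 0 w \<le> -x} = measure M {w \<in> space M. log_odds \<xi> 0 w \<ge> x}"
    and "\<alpha> \<in> {0<..<1}" and "c > 0"
    and "(\<lambda>r. measure M {w \<in> space M. log_odds \<xi> 0 w > r}) \<sim>[at_top] (\<lambda>r. c * r powr (-\<alpha>))"
    and "\<beta> \<in> {0<..<1}"
    and "\<And>n. n \<ge> 1 \<Longrightarrow> \<phi> n = 1 - real n powr (-\<beta>)"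
  shows "(\<beta> < 1 - \<alpha> \<longrightarrow> (AE w in M. recurrent_chain (walk_kernel (site_prob \<delta> chi \<xi> w)))) \<and>
         (\<beta> > 1 - \<alpha> \<longrightarrow>
            (\<delta> < 0 \<longrightarrow> (AE w in M. recurrent_chain (walk_kernel (site_prob \<delta> chi \<xi> w)))) \<and>
            (\<delta> > 0 \<longrightarrow> (AE w in M. transient_chain (walk_kernel (site_prob \<delta> chi \<xi> w)))))"
proof -
  interpret symmetric_heavy_environment M \<delta> \<phi> chi \<xi> \<alpha> \<beta> c
    using assms by (intro symmetric_heavy_environment.intro symmetric_heavy_environment_axioms.intro)
  show ?thesis
    using AE_recurrent_small_\<beta> AE_recurrent_large_\<beta> AE_transient_large_\<beta> by blast
qed

end
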